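(* Let $\mathfrak g$ be a finite-dimensional complex simple Lie algebra of type $A_n$, $B_n$, $C_n$ or $D_n$. For all $i\in I$ and $m\in\mathbb Z_+$ the $\mathfrak g[t]$-module $KR(m\omega_i)$ is finite-dimensional.
   Context: $\mathbb Z_+$ (resp. $\mathbb N$) is the set of non-negative (resp. positive) integers. $\mathfrak h$ is a Cartan subalgebra of $\mathfrak g$, $I=\{1,\dots,n\}$ indexes the simple roots $\alpha_i$ and fundamental weights $\omega_i$ (Bourbaki numbering), $R^+$ is the set of positive roots, $x^\pm_\alpha$ ($\alpha\in R^+$) are non-zero elements of the root spaces $\mathfrak g_{\pm\alpha}$, and $\mathfrak n^\pm=\bigoplus_{\alpha\in R^+}\mathfrak g_{\pm\alpha}$. $\mathfrak g[t]=\mathfrak g\otimes\mathbb C[t]$ is the current algebra; $\mathfrak g$ is identified with $\mathfrak g\otimes1$. $KR(m\omega_i)$ is the $\mathfrak g[t]$-module generated by an element $v_{i,m}$ with defining relations $$\mathfrak n^+[t]v_{i,m}=0,\quad hv_{i,m}=m\omega_i(h)v_{i,m},\quad (h\otimes t^r)v_{i,m}=0\ \ (h\in\mathfrak h,\ r\in\mathbb N),$$ $$(x^-_{\alpha_i})^{m+1}v_{i,m}=(x^-_{\alpha_i}\otimes t)v_{i,m}=x^-_{\alpha_j}v_{i,m}=0\ \ (j\in I\setminus\{i\}).$$ *)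

theory Defs
  imports
    "HOL-Computational_Algebra.Polynomial"
    "HOL-Library.Poly_Mapping"
    "HOL-Algebra.Module"
begin

section \<open>Complex Lie algebras\<close>

locale lie_algebra = vector_space scale
  for scale :: "complex \<Rightarrow> 'g::ab_group_add \<Rightarrow> 'g" +
  fixes bracket :: "'g \<Rightarrow> 'g \<Rightarrow> 'g"
  assumes bracket_add_left: "bracket (x + y) z = bracket x z + bracket y z"
    and bracket_add_right: "bracket x (y + z) = bracket x y + bracket x z"
    and bracket_scale_left: "bracket (scale c x) y = scale c (bracket x y)"
    and bracket_scale_right: "bracket x (scale c y) = scale c (bracket x y)"
    and bracket_self: "bracket x x = 0"
    and jacobi: "bracket x (bracket y z) + bracket y (bracket z x) + bracket z (bracket x y) = 0"
begin

definition finite_dimensional :: bool where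
  "finite_dimensional \<longleftrightarrow> (\<exists>B. finite B \<and> span B = UNIV)"

definition lie_ideal :: "'g set \<Rightarrow> bool" where
  "lie_ideal J \<longleftrightarrow> subspace J \<and> (\<forall>x. \<forall>y\<in>J. bracket x y \<in> J)"

definition simple :: bool where
  "simple \<longleftrightarrow> (\<exists>x y. bracket x y \<noteq> 0) \<and> (\<forall>J. lie_ideal J \<longrightarrow> J = {0} \<or> J = UNIV)"

text \<open>Cartan subalgebras in the form customary for complex semisimple Lie algebras:
  abelian, self-centralizing, and acting by diagonalizable operators.\<close>

definition cartan_subalgebra :: "'g set \<Rightarrow> bool" where
  "cartan_subalgebra H \<longleftrightarrow>
     subspace H \<and>
     (\<forall>h\<in>H. \<forall>k\<in>H. bracket h k = 0) \<and>
     (\<forall>x. (\<forall>h\<in>H. bracket h x = 0) \<longrightarrow> x \<in> H) \<and>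
     (\<forall>h\<in>H. span {x. \<exists>c. bracket h x = scale c x} = UNIV)"

text \<open>A functional on \<open>H\<close> is extended by 0 outside \<open>H\<close>, so that equality of functions
  on the whole type is equality in the dual space of \<open>H\<close>.\<close>

definition dual_space :: "'g set \<Rightarrow> ('g \<Rightarrow> complex) set" where
  "dual_space H = {a. (\<forall>x\<in>H. \<forall>y\<in>H. a (x + y) = a x + a y) \<and>
                      (\<forall>c. \<forall>x\<in>H. a (scale c x) = c * a x) \<and>
                      (\<forall>x. x \<notin> H \<longrightarrow> a x = 0)}"

definition root_space :: "'g set \<Rightarrow> ('g \<Rightarrow> complex) \<Rightarrow> 'g set" where
  "root_space H a = {x. \<forall>h\<in>H. bracket h x = scale (a h) x}"

definition roots :: "'g set \<Rightarrow> ('g \<Rightarrow> complex) set" where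
  "roots H = {a \<in> dual_space H. (\<exists>h\<in>H. a h \<noteq> 0) \<and> root_space H a \<noteq> {0}}"

definition simple_roots :: "'g set \<Rightarrow> nat \<Rightarrow> (nat \<Rightarrow> 'g \<Rightarrow> complex) \<Rightarrow> bool" where
  "simple_roots H n \<alpha> \<longleftrightarrow>
     (\<forall>i\<in>{1..n}. \<alpha> i \<in> roots H) \<and>
     (\<forall>c :: nat \<Rightarrow> complex. (\<forall>h\<in>H. (\<Sum>i = 1..n. c i * \<alpha> i h) = 0) \<longrightarrow> (\<forall>i\<in>{1..n}. c i = 0)) \<and>
     (\<forall>\<beta>\<in>roots H. \<exists>k :: nat \<Rightarrow> nat.
        (\<forall>h\<in>H. \<beta> h = (\<Sum>i = 1..n. of_nat (k i) * \<alpha> i h)) \<or>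
        (\<forall>h\<in>H. \<beta> h = - (\<Sum>i = 1..n. of_nat (k i) * \<alpha> i h)))"

definition positive_roots :: "'g set \<Rightarrow> nat \<Rightarrow> (nat \<Rightarrow> 'g \<Rightarrow> complex) \<Rightarrow> ('g \<Rightarrow> complex) set" where
  "positive_roots H n \<alpha> =
     {\<beta> \<in> roots H. \<exists>k :: nat \<Rightarrow> nat. \<forall>h\<in>H. \<beta> h = (\<Sum>i = 1..n. of_nat (k i) * \<alpha> i h)}"

definition n_plus :: "'g set \<Rightarrow> nat \<Rightarrow> (nat \<Rightarrow> 'g \<Rightarrow> complex) \<Rightarrow> 'g set" where
  "n_plus H n \<alpha> = span (\<Union>\<beta>\<in>positive_roots H n \<alpha>. root_space H \<beta>)"

text \<open>The coroot of \<open>\<beta>\<close> is the unique element \<open>h\<close> of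
  \<open>[\<gg>\<^sub>\<beta>, \<gg>\<^sub>-\<^sub>\<beta>]\<close> with \<open>\<beta>(h) = 2\<close>.\<close>

definition is_coroot :: "'g set \<Rightarrow> ('g \<Rightarrow> complex) \<Rightarrow> 'g \<Rightarrow> bool" where
  "is_coroot H \<beta> h \<longleftrightarrow>
     h \<in> span {bracket x y | x y. x \<in> root_space H \<beta> \<and> y \<in> root_space H (\<lambda>k. - \<beta> k)} \<and>
     \<beta> h = 2"

definition fundamental_weights ::
    "'g set \<Rightarrow> nat \<Rightarrow> (nat \<Rightarrow> 'g) \<Rightarrow> (nat \<Rightarrow> 'g \<Rightarrow> complex) \<Rightarrow> bool" where
  "fundamental_weights H n hc \<omega> \<longleftrightarrow>
     (\<forall>i\<in>{1..n}. \<omega> i \<in> dual_space H \<and> (\<forall>j\<in>{1..n}. \<omega> i (hc j) = (if i = j then 1 else 0)))"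

end

section \<open>Classical types\<close>

datatype classical_type = Type_A | Type_B | Type_C | Type_D

fun valid_rank :: "classical_type \<Rightarrow> nat \<Rightarrow> bool" where
  "valid_rank Type_A n \<longleftrightarrow> n \<ge> 1"
| "valid_rank Type_B n \<longleftrightarrow> n \<ge> 2"
| "valid_rank Type_C n \<longleftrightarrow> n \<ge> 2"
| "valid_rank Type_D n \<longleftrightarrow> n \<ge> 3"

text \<open>Bourbaki's Cartan matrices \<open>n(\<alpha>\<^sub>i, \<alpha>\<^sub>j) = \<langle>\<alpha>\<^sub>i, \<alpha>\<^sub>j\<^sup>\<or>\<rangle>\<close>, with \<open>i, j\<close> ranging over \<open>{1..n}\<close>:
  \<open>\<alpha>\<^sub>n\<close> is the short simple root in type B and the long one in type C.\<close>

definition chain_matrix :: "nat \<Rightarrow> nat \<Rightarrow> int" where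
  "chain_matrix i j = (if i = j then 2 else if i = j + 1 \<or> j = i + 1 then - 1 else 0)"

fun cartan_matrix :: "classical_type \<Rightarrow> nat \<Rightarrow> nat \<Rightarrow> nat \<Rightarrow> int" where
  "cartan_matrix Type_A n i j = chain_matrix i j"
| "cartan_matrix Type_B n i j =
     (if i + 1 = n \<and> j = n then - 2 else chain_matrix i j)"
| "cartan_matrix Type_C n i j =
     (if i = n \<and> j + 1 = n then - 2 else chain_matrix i j)"
| "cartan_matrix Type_D n i j =
     (if i + 1 = n \<and> j = n \<or> i = n \<and> j + 1 = n then 0
      else if i + 2 = n \<and> j = n \<or> i = n \<and> j + 2 = n then - 1
      else chain_matrix i j)"

context lie_algebra
begin

definition of_classical_type ::
    "classical_type \<Rightarrow> 'g set \<Rightarrow> nat \<Rightarrow> (nat \<Rightarrow> 'g \<Rightarrow> complex) \<Rightarrow> (nat \<Rightarrow> 'g) \<Rightarrow> bool" where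
  "of_classical_type X H n \<alpha> hc \<longleftrightarrow>
     valid_rank X n \<and>
     simple_roots H n \<alpha> \<and>
     (\<forall>i\<in>{1..n}. is_coroot H (\<alpha> i) (hc i)) \<and>
     (\<forall>i\<in>{1..n}. \<forall>j\<in>{1..n}. \<alpha> i (hc j) = of_int (cartan_matrix X n i j))"

end

section \<open>Current algebras\<close>

text \<open>\<open>\<gg> \<otimes> \<complex>[t]\<close> is identified with the polynomials with coefficients in \<open>\<gg>\<close>;
  \<open>x \<otimes> t\<^sup>r\<close> is \<open>monom x r\<close>.\<close>

definition current_scale ::
    "(complex \<Rightarrow> 'g::ab_group_add \<Rightarrow> 'g) \<Rightarrow> complex \<Rightarrow> 'g poly \<Rightarrow> 'g poly" where
  "current_scale scale c p = map_poly (scale c) p"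

definition current_bracket ::
    "('g::ab_group_add \<Rightarrow> 'g \<Rightarrow> 'g) \<Rightarrow> 'g poly \<Rightarrow> 'g poly \<Rightarrow> 'g poly" where
  "current_bracket bracket p q =
     (\<Sum>i\<le>degree p. \<Sum>j\<le>degree q. monom (bracket (coeff p i) (coeff q j)) (i + j))"

lemma bilinear_poly_sum:
  fixes f :: "'g::ab_group_add \<Rightarrow> 'g \<Rightarrow> 'g"
  assumes "\<And>y. f 0 y = 0" "\<And>x. f x 0 = 0"
  assumes "degree p \<le> M" "degree q \<le> N"
  shows "current_bracket f p q = (\<Sum>i\<le>M. \<Sum>j\<le>N. monom (f (coeff p i) (coeff q j)) (i + j))"
proof -
  have "(\<Sum>i\<le>M. \<Sum>j\<le>N. monom (f (coeff p i) (coeff q j)) (i + j))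
      = (\<Sum>i\<le>degree p. \<Sum>j\<le>N. monom (f (coeff p i) (coeff q j)) (i + j))"
    using assms by (intro sum.mono_neutral_right) (auto simp: coeff_eq_0)
  also have "\<dots> = (\<Sum>i\<le>degree p. \<Sum>j\<le>degree q. monom (f (coeff p i) (coeff q j)) (i + j))"
    using assms by (intro sum.cong refl sum.mono_neutral_right) (auto simp: coeff_eq_0)
  finally show ?thesis by (simp add: current_bracket_def)
qed

lemma coeff_current_scale:
  assumes "scale c 0 = 0"
  shows "coeff (current_scale scale c p) r = scale c (coeff p r)"
  by (simp add: current_scale_def coeff_map_poly assms)

context lie_algebra
begin

lemma bracket_0 [simp]: "bracket 0 x = 0" "bracket x 0 = 0"
  using bracket_add_left[of 0 0 x] bracket_add_right[of x 0 0] by auto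

lemma coeff_current_bracket:
  "coeff (current_bracket bracket p q) r = (\<Sum>i\<le>r. bracket (coeff p i) (coeff q (r - i)))"
proof -
  have "current_bracket bracket p q =
      (\<Sum>i\<le>max r (degree p). \<Sum>j\<le>max r (degree q). monom (bracket (coeff p i) (coeff q j)) (i + j))"
    by (rule bilinear_poly_sum) auto
  then have "coeff (current_bracket bracket p q) r =
      (\<Sum>i\<le>max r (degree p). \<Sum>j\<le>max r (degree q). if i + j = r then bracket (coeff p i) (coeff q j) else 0)"
    by (simp add: coeff_sum)
  also have "\<dots> = (\<Sum>i\<le>max r (degree p). if i \<le> r then bracket (coeff p i) (coeff q (r - i)) else 0)"
  proof (intro sum.cong refl)
    fix i
    have "(\<Sum>j\<le>max r (degree q). if i + j = r then bracket (coeff p i) (coeff q j) else 0) =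
        (\<Sum>j\<le>max r (degree q). if j = r - i then (if i \<le> r then bracket (coeff p i) (coeff q j) else 0) else 0)"
      by (intro sum.cong refl) auto
    also have "\<dots> = (if i \<le> r then bracket (coeff p i) (coeff q (r - i)) else 0)"
      by (subst sum.delta) auto
    finally show "(\<Sum>j\<le>max r (degree q). if i + j = r then bracket (coeff p i) (coeff q j) else 0) =
        (if i \<le> r then bracket (coeff p i) (coeff q (r - i)) else 0)" .
  qed
  also have "\<dots> = (\<Sum>i\<le>r. bracket (coeff p i) (coeff q (r - i)))"
    by (intro sum.mono_neutral_cong_right) auto
  finally show ?thesis .
qed

lemma bracket_sum_right: "bracket x (sum f A) = (\<Sum>a\<in>A. bracket x (f a))"
  by (induction A rule: infinite_finite_induct) (auto simp: bracket_add_right)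

lemma bracket_flip: "bracket x y = - bracket y x"
proof -
  have "bracket x y + bracket y x = 0"
    using bracket_self[of "x + y", unfolded bracket_add_left bracket_add_right] bracket_self
    by (simp add: add.commute)
  then show ?thesis by (simp add: eq_neg_iff_add_eq_0)
qed

lemma current_bracket_add:
  "current_bracket bracket (p + p') q = current_bracket bracket p q + current_bracket bracket p' q"
  "current_bracket bracket q (p + p') = current_bracket bracket q p + current_bracket bracket q p'"
  by (auto simp: poly_eq_iff coeff_current_bracket bracket_add_left bracket_add_right sum.distrib)

lemma current_bracket_flip: "current_bracket bracket p q = - current_bracket bracket q p"
proof (rule poly_eqI)
  fix r
  have "(\<Sum>i\<le>r. bracket (coeff p i) (coeff q (r - i))) = (\<Sum>i\<le>r. bracket (coeff p (r - i)) (coeff q i))"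
    by (rule sum.reindex_bij_witness[of _ "\<lambda>i. r - i" "\<lambda>i. r - i"]) auto
  also have "\<dots> = - (\<Sum>i\<le>r. bracket (coeff q i) (coeff p (r - i)))"
    by (simp add: sum_negf[symmetric] bracket_flip[of "coeff q _"])
  finally show "coeff (current_bracket bracket p q) r = coeff (- current_bracket bracket q p) r"
    by (simp add: coeff_current_bracket)
qed

lemma current_bracket_monom:
  "current_bracket bracket (monom x r) (monom y s) = monom (bracket x y) (r + s)"
proof (rule poly_eqI)
  fix k
  have "(\<Sum>i\<le>k. bracket (coeff (monom x r) i) (coeff (monom y s) (k - i)))
      = (\<Sum>i\<le>k. if i = r then (if k - i = s then bracket x y else 0) else 0)"
    by (intro sum.cong refl) auto
  then show "coeff (current_bracket bracket (monom x r) (monom y s)) k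
      = coeff (monom (bracket x y) (r + s)) k"
    by (auto simp: coeff_current_bracket sum.delta)
qed

lemma poly_monom_induct [case_names monom add]:
  fixes p :: "'g poly"
  assumes "\<And>x r. P (monom x r)" "\<And>p q. P p \<Longrightarrow> P q \<Longrightarrow> P (p + q)"
  shows "P p"
proof -
  have "P (\<Sum>i\<le>N. monom (coeff p i) i)" for N
    by (induction N) (auto intro: assms)
  moreover have "p = (\<Sum>i\<le>degree p. monom (coeff p i) i)"
    by (auto simp: poly_eq_iff coeff_sum coeff_eq_0)
  ultimately show ?thesis by metis
qed

lemma current_bracket_self: "current_bracket bracket p p = 0"
proof (induction p rule: poly_monom_induct)
  case (add p q)
  then show ?case
    using current_bracket_flip[of p q] by (simp add: current_bracket_add)
qed (simp add: current_bracket_monom bracket_self)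

lemma current_jacobi:
  "current_bracket bracket p (current_bracket bracket q s) +
   current_bracket bracket q (current_bracket bracket s p) +
   current_bracket bracket s (current_bracket bracket p q) = 0"
proof -
  define J where "J p q s = current_bracket bracket p (current_bracket bracket q s) +
      current_bracket bracket q (current_bracket bracket s p) +
      current_bracket bracket s (current_bracket bracket p q)" for p q s
  have J_add: "J (p + p') q s = J p q s + J p' q s" "J q (p + p') s = J q p s + J q p' s"
    "J q s (p + p') = J q s p + J q s p'" for p p' q s
    unfolding J_def current_bracket_add by (simp_all only: ac_simps)
  have J_monom: "J (monom x a) (monom y b) (monom z c) = 0" for x y z a b c
    using jacobi[of x y z] by (simp add: J_def current_bracket_monom add_monom ac_simps)
  have "J (monom x a) (monom y b) s = 0" for x y a b
    by (induction s rule: poly_monom_induct) (simp_all add: J_add J_monom)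
  then have "J (monom x a) q s = 0" for x a
    by (induction q rule: poly_monom_induct) (simp_all add: J_add)
  then have "J p q s = 0"
    by (induction p rule: poly_monom_induct) (simp_all add: J_add)
  then show ?thesis by (simp add: J_def)
qed

lemma lie_algebra_current:
  "lie_algebra (current_scale scale) (current_bracket bracket)"
proof
  have coeff_scale: "coeff (current_scale scale c p) r = scale c (coeff p r)" for c p r
    by (simp add: coeff_current_scale)
  fix a b :: complex and p q s :: "'g poly"
  show "current_scale scale a (p + q) = current_scale scale a p + current_scale scale a q"
    "current_scale scale (a + b) p = current_scale scale a p + current_scale scale b p"
    "current_scale scale a (current_scale scale b p) = current_scale scale (a * b) p"
    "current_scale scale 1 p = p"
    by (auto simp: poly_eq_iff coeff_scale scale_right_distrib scale_left_distrib)
  show "current_bracket bracket (current_scale scale a p) q = current_scale scale a (current_bracket bracket p q)"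
    "current_bracket bracket p (current_scale scale a q) = current_scale scale a (current_bracket bracket p q)"
    by (auto simp: poly_eq_iff coeff_scale coeff_current_bracket bracket_scale_left bracket_scale_right
        scale_sum_right)
qed (simp_all add: current_bracket_add current_bracket_self current_jacobi)

end

section \<open>Modules given by a generator and defining relations\<close>

text \<open>The free associative algebra on the underlying set of a Lie algebra \<open>L\<close> is the monoid
  algebra of the words in \<open>L\<close>; the wrapper type turns concatenation into the addition that
  the product of \<^typ>\<open>'a \<Rightarrow>\<^sub>0 'b\<close> uses.\<close>

datatype 'l free_monoid = Word (letters: "'l list")

instantiation free_monoid :: (type) monoid_add
begin
definition zero_free_monoid :: "'a free_monoid" where "0 = Word []"
definition plus_free_monoid :: "'a free_monoid \<Rightarrow> 'a free_monoid \<Rightarrow> 'a free_monoid" where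
  "u + w = Word (letters u @ letters w)"
instance
  by standard (auto simp: zero_free_monoid_def plus_free_monoid_def)
end

type_synonym 'l free_algebra = "'l free_monoid \<Rightarrow>\<^sub>0 complex"

definition generator :: "'l \<Rightarrow> 'l free_algebra" where
  "generator x = Poly_Mapping.single (Word [x]) 1"

definition scalar :: "complex \<Rightarrow> 'l free_algebra" where
  "scalar c = Poly_Mapping.single 0 c"

definition left_ideal :: "'a::ring_1 set \<Rightarrow> bool" where
  "left_ideal J \<longleftrightarrow> 0 \<in> J \<and> (\<forall>p\<in>J. \<forall>q\<in>J. p + q \<in> J) \<and> (\<forall>a. \<forall>p\<in>J. a * p \<in> J)"

definition two_sided_ideal :: "'a::ring_1 set \<Rightarrow> bool" where
  "two_sided_ideal J \<longleftrightarrow> left_ideal J \<and> (\<forall>a. \<forall>p\<in>J. p * a \<in> J)"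

text \<open>The kernel of the projection from the free algebra onto the universal enveloping
  algebra \<open>U(L)\<close>.\<close>

definition enveloping_ideal ::
    "(complex \<Rightarrow> 'l::ab_group_add \<Rightarrow> 'l) \<Rightarrow> ('l \<Rightarrow> 'l \<Rightarrow> 'l) \<Rightarrow> 'l free_algebra set" where
  "enveloping_ideal scale bracket = two_sided_ideal hull
     ({generator (x + y) - generator x - generator y | x y. True} \<union>
      {generator (scale c x) - scalar c * generator x | c x. True} \<union>
      {generator x * generator y - generator y * generator x - generator (bracket x y) | x y. True})"

text \<open>The preimage in the free algebra of the left ideal of \<open>U(L)\<close> generated by \<open>R\<close>.\<close>

definition relation_ideal ::
    "(complex \<Rightarrow> 'l::ab_group_add \<Rightarrow> 'l) \<Rightarrow> ('l \<Rightarrow> 'l \<Rightarrow> 'l) \<Rightarrow> 'l free_algebra set \<Rightarrow>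
     'l free_algebra set" where
  "relation_ideal scale bracket R = left_ideal hull (enveloping_ideal scale bracket \<union> R)"

definition coset :: "'a::ring_1 set \<Rightarrow> 'a \<Rightarrow> 'a set" where
  "coset N p = {p + u | u. u \<in> N}"

record ('k, 'l, 'm) lie_module = "('k, 'm) module" +
  act :: "'l \<Rightarrow> 'm \<Rightarrow> 'm"

text \<open>The \<open>L\<close>-module with a generator \<open>v\<close> and defining relations \<open>r v = 0\<close> for \<open>r \<in> R\<close>,
  namely \<open>U(L) / U(L)R\<close> with \<open>v\<close> the coset of 1.
  As usual for modules in HOL-Algebra, the ring fields \<open>mult\<close> and \<open>one\<close> carry no meaning.\<close>

definition presented_module ::
    "(complex \<Rightarrow> 'l::ab_group_add \<Rightarrow> 'l) \<Rightarrow> ('l \<Rightarrow> 'l \<Rightarrow> 'l) \<Rightarrow> 'l free_algebra set \<Rightarrow>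
     (complex, 'l, 'l free_algebra set) lie_module" where
  "presented_module scale bracket R =
     (let N = relation_ideal scale bracket R in
      \<lparr>carrier = range (coset N),
       mult = undefined,
       one = undefined,
       zero = N,
       add = (\<lambda>C D. {p + q | p q. p \<in> C \<and> q \<in> D}),
       smult = (\<lambda>c C. \<Union>p\<in>C. coset N (scalar c * p)),
       act = (\<lambda>x C. \<Union>p\<in>C. coset N (generator x * p))\<rparr>)"

definition finite_dimensional_module :: "(complex, 'm, 'z) module_scheme \<Rightarrow> bool" where
  "finite_dimensional_module M \<longleftrightarrow>
     (\<exists>B. finite B \<and> B \<subseteq> carrier M \<and>
        (\<forall>v\<in>carrier M. \<exists>c. v = (\<Oplus>\<^bsub>M\<^esub>b\<in>B. c b \<odot>\<^bsub>M\<^esub> b)))"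

lemma free_algebra_induct [case_names single sum]:
  fixes p :: "'l free_algebra"
  assumes single: "\<And>k c. P (Poly_Mapping.single k c)"
    and sum: "\<And>p q. P p \<Longrightarrow> P q \<Longrightarrow> P (p + q)"
  shows "P p"
proof (induction p rule: update_induct)
  case const
  then show ?case using single[of 0 0] by simp
next
  case (update f a b)
  have "Poly_Mapping.update a b f = Poly_Mapping.single a b + f"
    using update(1)
    by (intro poly_mapping_eqI)
       (auto simp: lookup_update lookup_add lookup_single when_def in_keys_iff)
  then show ?case using single sum update by metis
qed

lemma left_ideal_relation_ideal: "left_ideal (relation_ideal scale bracket R)"
  unfolding relation_ideal_def by (rule hull_in) (auto simp: left_ideal_def)

lemma two_sided_ideal_enveloping_ideal: "two_sided_ideal (enveloping_ideal scale bracket)"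
  unfolding enveloping_ideal_def by (rule hull_in) (auto simp: two_sided_ideal_def left_ideal_def)

lemma coset_eq_iff:
  assumes "left_ideal N"
  shows "coset N p = coset N q \<longleftrightarrow> p - q \<in> N"
proof
  assume "coset N p = coset N q"
  moreover have "p \<in> coset N p"
    using assms by (force simp: coset_def left_ideal_def)
  ultimately show "p - q \<in> N" by (auto simp: coset_def)
next
  have sub: "coset N p \<subseteq> coset N q" if "p - q \<in> N" for p q
  proof
    fix x assume "x \<in> coset N p"
    then obtain u where "u \<in> N" "x = p + u" by (auto simp: coset_def)
    then have "x = q + ((p - q) + u)" "(p - q) + u \<in> N"
      using assms that by (auto simp: left_ideal_def)
    then show "x \<in> coset N q" unfolding coset_def by blast
  qed
  assume "p - q \<in> N"
  moreover from this have "q - p \<in> N"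
    using assms by (metis left_ideal_def minus_diff_eq mult_minus1)
  ultimately show "coset N p = coset N q" using sub by blast
qed

lemma coset_mult:
  assumes "left_ideal N"
  shows "(\<Union>p\<in>coset N q. coset N (a * p)) = coset N (a * q)"
proof -
  have "coset N (a * p) = coset N (a * q)" if p: "p \<in> coset N q" for p
  proof -
    obtain u where "u \<in> N" "p = q + u" using p by (auto simp: coset_def)
    then have "a * p - a * q \<in> N" using assms by (simp add: left_ideal_def algebra_simps)
    then show ?thesis by (simp add: coset_eq_iff[OF assms])
  qed
  moreover have "q \<in> coset N q"
    using assms by (force simp: coset_def left_ideal_def)
  ultimately show ?thesis by blast
qed

lemma coset_add:
  assumes "left_ideal N"
  shows "{p + q | p q. p \<in> coset N a \<and> q \<in> coset N b} = coset N (a + b)"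
proof -
  have 1: "\<exists>p q. x = p + q \<and> p \<in> coset N a \<and> q \<in> coset N b" if "x \<in> coset N (a + b)" for x
  proof -
    from that obtain u where "u \<in> N" "x = (a + 0) + (b + u)" by (auto simp: coset_def add.assoc)
    moreover have "0 \<in> N" using assms by (simp add: left_ideal_def)
    ultimately show ?thesis unfolding coset_def by blast
  qed
  have 2: "p + q \<in> coset N (a + b)" if pq: "p \<in> coset N a" "q \<in> coset N b" for p q
  proof -
    obtain u v where uv: "u \<in> N" "v \<in> N" "p = a + u" "q = b + v" using pq by (auto simp: coset_def)
    then have "p + q = (a + b) + (u + v)" by (simp add: algebra_simps)
    moreover have "u + v \<in> N" using assms uv by (simp add: left_ideal_def)
    ultimately show ?thesis unfolding coset_def by blast
  qed
  show ?thesis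
    using 1 2 by blast
qed

definition complex_ring :: "complex ring" where
  "complex_ring = \<lparr>carrier = UNIV, mult = (*), one = 1, zero = 0, add = (+)\<rparr>"

lemma cring_complex_ring: "cring complex_ring"
  unfolding complex_ring_def
  by (rule cringI)
     (auto intro!: abelian_groupI comm_monoidI exI[of _ "- _"] simp: algebra_simps intro: exI[of _ "- x" for x])

lemma scalar_simps:
  "scalar (a + b) = scalar a + scalar b" "scalar (a * b) = scalar a * scalar b"
  "scalar 1 = 1" "scalar 0 = 0"
  by (simp_all add: scalar_def single_add mult_single)

lemma scalar_commute: "scalar c * p = p * scalar c"
proof (induction p rule: free_algebra_induct)
  case (single k v)
  then show ?case by (simp add: scalar_def mult_single mult.commute)
qed (simp add: algebra_simps)

context
  fixes scale :: "complex \<Rightarrow> 'l::ab_group_add \<Rightarrow> 'l"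
    and bracket :: "'l \<Rightarrow> 'l \<Rightarrow> 'l"
    and R :: "'l free_algebra set"
begin

private abbreviation "N \<equiv> relation_ideal scale bracket R"
private abbreviation "M \<equiv> presented_module scale bracket R"

lemma presented_module_simps:
  "carrier M = range (coset N)"
  "\<zero>\<^bsub>M\<^esub> = coset N 0"
  "coset N p \<oplus>\<^bsub>M\<^esub> coset N q = coset N (p + q)"
  "c \<odot>\<^bsub>M\<^esub> coset N p = coset N (scalar c * p)"
  "act M x (coset N p) = coset N (generator x * p)"
  by (simp_all add: presented_module_def Let_def coset_mult coset_add left_ideal_relation_ideal)
     (simp add: coset_def)

lemma module_presented_module: "Module.module complex_ring M"
proof (rule moduleI)
  show "abelian_group M"
  proof (rule abelian_groupI)
    fix x assume "x \<in> carrier M"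
    then obtain p where "x = coset N p" by (auto simp: presented_module_simps)
    then show "\<exists>y\<in>carrier M. y \<oplus>\<^bsub>M\<^esub> x = \<zero>\<^bsub>M\<^esub>"
      by (intro bexI[of _ "coset N (- p)"]) (auto simp: presented_module_simps)
  qed (auto simp: presented_module_simps algebra_simps)
qed (auto simp: presented_module_simps complex_ring_def scalar_simps algebra_simps
    intro!: cring_complex_ring[unfolded complex_ring_def])

text \<open>The action is a representation, and the coset of 1 is a generator satisfying
  the relations.\<close>

lemma enveloping_relations_in:
  "generator (x + y) - generator x - generator y \<in> enveloping_ideal scale bracket"
  "generator (scale c x) - scalar c * generator x \<in> enveloping_ideal scale bracket"
  "generator x * generator y - generator y * generator x - generator (bracket x y)
     \<in> enveloping_ideal scale bracket"
  unfolding enveloping_ideal_def by (rule hull_inc, blast)+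

lemma enveloping_ideal_mult:
  "p \<in> enveloping_ideal scale bracket \<Longrightarrow> p * q \<in> N"
  using two_sided_ideal_enveloping_ideal[of scale bracket]
  by (auto simp: two_sided_ideal_def relation_ideal_def intro!: hull_inc)

lemma presented_module_act:
  assumes "v \<in> carrier M" "w \<in> carrier M"
  shows "act M x v \<in> carrier M"
    and "act M x (v \<oplus>\<^bsub>M\<^esub> w) = act M x v \<oplus>\<^bsub>M\<^esub> act M x w"
    and "act M x (c \<odot>\<^bsub>M\<^esub> v) = c \<odot>\<^bsub>M\<^esub> act M x v"
    and "act M (x + y) v = act M x v \<oplus>\<^bsub>M\<^esub> act M y v"
    and "act M (scale c x) v = c \<odot>\<^bsub>M\<^esub> act M x v"
    and "act M x (act M y v) = act M y (act M x v) \<oplus>\<^bsub>M\<^esub> act M (bracket x y) v"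
proof -
  obtain p q where [simp]: "v = coset N p" "w = coset N q"
    using assms by (auto simp: presented_module_simps)
  note rel = enveloping_ideal_mult[OF enveloping_relations_in(1), of x y p]
    enveloping_ideal_mult[OF enveloping_relations_in(2), of c x p]
    enveloping_ideal_mult[OF enveloping_relations_in(3), of x y p]
  show "act M x v \<in> carrier M"
    "act M x (v \<oplus>\<^bsub>M\<^esub> w) = act M x v \<oplus>\<^bsub>M\<^esub> act M x w"
    by (auto simp: presented_module_simps algebra_simps)
  show "act M x (c \<odot>\<^bsub>M\<^esub> v) = c \<odot>\<^bsub>M\<^esub> act M x v"
    using scalar_commute[of c "generator x"]
    by (simp add: presented_module_simps mult.assoc[symmetric])
  show "act M (x + y) v = act M x v \<oplus>\<^bsub>M\<^esub> act M y v"
    "act M (scale c x) v = c \<odot>\<^bsub>M\<^esub> act M x v"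
    "act M x (act M y v) = act M y (act M x v) \<oplus>\<^bsub>M\<^esub> act M (bracket x y) v"
    using rel
    by (simp_all add: presented_module_simps coset_eq_iff[OF left_ideal_relation_ideal] algebra_simps)
qed

lemma presented_module_relation: "r \<in> R \<Longrightarrow> coset N r = \<zero>\<^bsub>M\<^esub>"
  by (simp add: presented_module_simps coset_eq_iff[OF left_ideal_relation_ideal])
     (simp add: relation_ideal_def hull_inc)

lemma presented_module_generated:
  assumes "coset N 1 \<in> W" "\<zero>\<^bsub>M\<^esub> \<in> W"
    and "\<And>v w. v \<in> W \<Longrightarrow> w \<in> W \<Longrightarrow> v \<oplus>\<^bsub>M\<^esub> w \<in> W"
    and "\<And>c v. v \<in> W \<Longrightarrow> c \<odot>\<^bsub>M\<^esub> v \<in> W"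
    and "\<And>x v. v \<in> W \<Longrightarrow> act M x v \<in> W"
  shows "carrier M \<subseteq> W"
proof -
  have word: "coset N (Poly_Mapping.single (Word xs) 1) \<in> W" for xs
  proof (induction xs)
    case Nil
    then show ?case using assms(1) by (simp add: zero_free_monoid_def[symmetric])
  next
    case (Cons x xs)
    have "generator x * Poly_Mapping.single (Word xs) 1 = Poly_Mapping.single (Word (x # xs)) 1"
      by (simp add: generator_def mult_single plus_free_monoid_def)
    then show ?case using assms(5)[OF Cons, of x] by (simp add: presented_module_simps)
  qed
  have "coset N p \<in> W" for p
  proof (induction p rule: free_algebra_induct)
    case (single k c)
    have "scalar c * Poly_Mapping.single (Word (letters k)) 1 = Poly_Mapping.single k c"
      by (simp add: scalar_def mult_single)
    then show ?case using assms(4)[OF word, of c "letters k"] by (simp add: presented_module_simps)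
  next
    case (sum p q)
    then show ?case using assms(3)[of "coset N p" "coset N q"] by (simp add: presented_module_simps)
  qed
  then show ?thesis by (auto simp: presented_module_simps)
qed

end

section \<open>Kirillov--Reshetikhin modules\<close>

context lie_algebra
begin

text \<open>\<open>xm \<beta>\<close> stands for \<open>x\<^sup>-\<^sub>\<beta>\<close>. The element \<open>r\<close> of the free algebra represents the
  relation \<open>r v = 0\<close>.\<close>

definition KR_relations ::
    "'g set \<Rightarrow> nat \<Rightarrow> (nat \<Rightarrow> 'g \<Rightarrow> complex) \<Rightarrow> (nat \<Rightarrow> 'g \<Rightarrow> complex) \<Rightarrow>
     (('g \<Rightarrow> complex) \<Rightarrow> 'g) \<Rightarrow> nat \<Rightarrow> nat \<Rightarrow> 'g poly free_algebra set" where
  "KR_relations H n \<alpha> \<omega> xm m i =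
     {generator p | p. \<forall>r. coeff p r \<in> n_plus H n \<alpha>} \<union>
     {generator (monom h 0) - scalar (of_nat m * \<omega> i h) | h. h \<in> H} \<union>
     {generator (monom h r) | h r. h \<in> H \<and> r \<ge> 1} \<union>
     {generator (monom (xm (\<alpha> i)) 0) ^ (m + 1), generator (monom (xm (\<alpha> i)) 1)} \<union>
     {generator (monom (xm (\<alpha> j)) 0) | j. j \<in> {1..n} - {i}}"

definition KR ::
    "'g set \<Rightarrow> nat \<Rightarrow> (nat \<Rightarrow> 'g \<Rightarrow> complex) \<Rightarrow> (nat \<Rightarrow> 'g \<Rightarrow> complex) \<Rightarrow>
     (('g \<Rightarrow> complex) \<Rightarrow> 'g) \<Rightarrow> nat \<Rightarrow> nat \<Rightarrow>
     (complex, 'g poly, 'g poly free_algebra set) lie_module" where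
  "KR H n \<alpha> \<omega> xm m i =
     presented_module (current_scale scale) (current_bracket bracket) (KR_relations H n \<alpha> \<omega> xm m i)"

end

end

theory Submission
  imports Defs
begin

text \<open>Call an element of \<open>\<gg>[t]\<close> good if it acts locally nilpotently both in the adjoint representation and on
  \<open>KR(m\<omega>\<^sub>i)\<close>. For good \<open>s\<close> and \<open>x\<close> the element \<open>exp(ad s) x\<close> is good as well, because
  \<open>exp(s)\<close> intertwines \<open>x\<close> with it; comparing coefficients in \<open>exp(c ad s) x\<close>, the span of the good
  elements is a Lie subalgebra. It contains all \<open>x\<^sup>+\<^sub>\<beta> \<otimes> t\<^sup>r\<close> and all \<open>x\<^sup>-\<^sub>\<alpha>\<^sub>j\<close>, which generate \<open>\<gg>[t]\<close>,
  so \<open>\<gg>[t]\<close> is spanned by good elements. Moreover \<open>t\<^sup>N\<gg>[t]\<close> kills the module for large \<open>N\<close>. Hence finitely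
  many good elements suffice, and ordered monomials in them, applied to the generator, span the module
  and are nonzero only finitely often.

  That a subalgebra \<open>M\<close> of \<open>\<gg>\<close> with \<open>\<nn>\<^sup>+ \<subseteq> M\<close> and \<open>x\<^sup>-\<^sub>\<alpha>\<^sub>j \<in> M\<close> is all of \<open>\<gg>\<close> uses no Killing form: positivity of
  the Cartan matrix gives for each positive \<open>\<beta>\<close> some \<open>j\<close> with \<open>\<beta>(h\<^sub>j) > 0\<close>, then \<open>\<gg>\<^sub>-\<^sub>\<beta> = [x\<^sup>-\<^sub>\<alpha>\<^sub>j, \<gg>\<^sub>\<alpha>\<^sub>j\<^sub>-\<^sub>\<beta>]\<close> by
  the representation theory of \<open>\<ss>\<ll>\<^sub>2\<close>, and \<open>M\<close>, containing all root vectors, is an ideal.\<close>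

section \<open>Locally nilpotent elements in representations\<close>

definition locally_nilpotent :: "('v::zero \<Rightarrow> 'v) \<Rightarrow> bool" where
  "locally_nilpotent T \<longleftrightarrow> (\<forall>v. \<exists>k. (T ^^ k) v = 0)"

lemma funpow_zero_mono:
  fixes T :: "'v::zero \<Rightarrow> 'v"
  assumes "T 0 = 0" "(T ^^ k) v = 0" "k \<le> l"
  shows "(T ^^ l) v = 0"
proof -
  have "(T ^^ j) 0 = 0" for j by (induction j) (simp_all add: assms(1))
  moreover have "(T ^^ l) v = (T ^^ (l - k)) ((T ^^ k) v)"
    using assms(3) funpow_add[of "l - k" k T] by simp
  ultimately show ?thesis by (simp add: assms(2))
qed

text \<open>Writing p(c) for the sum with top index K, the combination p(2c) - 2^K p(c) loses its
  top term and has coefficients (2^k - 2^K) a_k, so induction applies. The result extracts single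
  coefficients from a one-parameter family inside \<open>G\<close>.\<close>

lemma (in lie_algebra) subspace_polynomial_coeffs:
  assumes G: "subspace G"
    and p: "\<And>c. (\<Sum>k<K. scale (c ^ k) (a k)) \<in> G" and k: "k < K"
  shows "a k \<in> G"
  using p k
proof (induction K arbitrary: a k)
  case (Suc K)
  have *: "a k \<in> G" if "k < K" for k
  proof -
    have "scale (2 ^ k - 2 ^ K) (a k) \<in> G"
    proof (rule Suc.IH[OF _ that])
      fix c
      have "(\<Sum>k<K. scale (c ^ k) (scale (2 ^ k - 2 ^ K) (a k)))
          = (\<Sum>k<Suc K. scale ((2 * c) ^ k) (a k)) - scale (2 ^ K) (\<Sum>k<Suc K. scale (c ^ k) (a k))"
        by (simp add: scale_sum_right scale_right_distrib scale_left_diff_distrib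
            power_mult_distrib sum_subtractf[symmetric] algebra_simps)
      then show "(\<Sum>k<K. scale (c ^ k) (scale (2 ^ k - 2 ^ K) (a k))) \<in> G"
        using Suc.prems(1)[of "2 * c"] Suc.prems(1)[of c] G
        by (auto intro!: subspace_diff subspace_scale)
    qed
    then have "scale (inverse (2 ^ k - 2 ^ K)) (scale (2 ^ k - 2 ^ K) (a k)) \<in> G"
      using G subspace_scale by blast
    moreover have "(2 ^ k - 2 ^ K :: complex) \<noteq> 0"
    proof
      assume "(2 ^ k - 2 ^ K :: complex) = 0"
      then have "norm ((2 :: complex) ^ k) = norm ((2 :: complex) ^ K)" by simp
      then show False using that by (simp add: norm_power)
    qed
    ultimately show ?thesis by simp
  qed
  moreover have "a K \<in> G"
  proof -
    have "a K = (\<Sum>k<Suc K. scale (1 ^ k) (a k)) - (\<Sum>k<K. a k)" by simp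
    then show ?thesis using Suc.prems(1)[of 1] * G
      by (metis lessThan_iff subspace_diff subspace_sum)
  qed
  ultimately show ?case using Suc.prems(2) less_Suc_eq by blast
qed simp

locale lie_rep = lie_algebra scale bracket + V: vector_space scaleV
  for scale :: "complex \<Rightarrow> 'g::ab_group_add \<Rightarrow> 'g" and bracket
    and scaleV :: "complex \<Rightarrow> 'v::ab_group_add \<Rightarrow> 'v" +
  fixes \<rho> :: "'g \<Rightarrow> 'v \<Rightarrow> 'v"
  assumes rep_add_left: "\<rho> (x + y) v = \<rho> x v + \<rho> y v"
    and rep_scale_left: "\<rho> (scale c x) v = scaleV c (\<rho> x v)"
    and rep_add_right: "\<rho> x (v + w) = \<rho> x v + \<rho> x w"
    and rep_scale_right: "\<rho> x (scaleV c v) = scaleV c (\<rho> x v)"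
    and rep_bracket: "\<rho> (bracket x y) v = \<rho> x (\<rho> y v) - \<rho> y (\<rho> x v)"
begin

lemma rep_0 [simp]: "\<rho> 0 v = 0" "\<rho> x 0 = 0"
  using rep_add_left[of 0 0 v] rep_add_right[of x 0 0] by auto

lemma rep_minus: "\<rho> (- x) v = - \<rho> x v" "\<rho> x (- v) = - \<rho> x v"
  using rep_add_left[of x "- x" v] rep_add_right[of x v "- v"]
  by (simp_all add: eq_neg_iff_add_eq_0 add.commute)

lemma rep_diff: "\<rho> (x - y) v = \<rho> x v - \<rho> y v" "\<rho> x (v - w) = \<rho> x v - \<rho> x w"
  by (simp_all only: diff_conv_add_uminus rep_add_left rep_add_right rep_minus)

lemma rep_sum: "\<rho> (sum f A) v = (\<Sum>a\<in>A. \<rho> (f a) v)" "\<rho> x (sum g A) = (\<Sum>a\<in>A. \<rho> x (g a))"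
  by (induction A rule: infinite_finite_induct) (auto simp: rep_add_left rep_add_right)

lemma rep_pow_0 [simp]: "(\<rho> x ^^ k) 0 = 0"
  by (induction k) simp_all

lemma rep_pow_linear:
  "(\<rho> x ^^ k) (v + w) = (\<rho> x ^^ k) v + (\<rho> x ^^ k) w"
  "(\<rho> x ^^ k) (scaleV c v) = scaleV c ((\<rho> x ^^ k) v)"
  "(\<rho> (scale c x) ^^ k) v = scaleV (c ^ k) ((\<rho> x ^^ k) v)"
  by (induction k) (simp_all add: rep_add_right rep_scale_right rep_scale_left mult.commute)

text \<open>Because of this, local nilpotency only has to be tested on a spanning set.\<close>

lemma subspace_rep_nilpotent: "V.subspace {v. \<exists>k. (\<rho> x ^^ k) v = 0}"
proof (rule V.subspaceI)
  fix v w assume "v \<in> {v. \<exists>k. (\<rho> x ^^ k) v = 0}" "w \<in> {v. \<exists>k. (\<rho> x ^^ k) v = 0}"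
  then obtain k l where "(\<rho> x ^^ k) v = 0" "(\<rho> x ^^ l) w = 0" by auto
  then have "(\<rho> x ^^ max k l) v = 0" "(\<rho> x ^^ max k l) w = 0"
    by (meson funpow_zero_mono max.cobounded1 max.cobounded2 rep_0(2))+
  then show "v + w \<in> {v. \<exists>k. (\<rho> x ^^ k) v = 0}"
    by (auto simp: rep_pow_linear intro!: exI[of _ "max k l"])
qed (auto simp: rep_pow_linear)

lemma locally_nilpotent_scale:
  "locally_nilpotent (\<rho> x) \<Longrightarrow> locally_nilpotent (\<rho> (scale c x))"
  by (metis locally_nilpotent_def rep_pow_linear(3) V.scale_zero_right)

text \<open>Divided powers \<open>\<rho>(x)\<^sup>k / k!\<close>, for which the Leibniz rule has no binomial coefficients.\<close>

definition divpow :: "'g \<Rightarrow> nat \<Rightarrow> 'v \<Rightarrow> 'v" where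
  "divpow x k v = scaleV (1 / fact k) ((\<rho> x ^^ k) v)"

lemma divpow_Suc: "\<rho> x (divpow x k v) = scaleV (of_nat (Suc k)) (divpow x (Suc k) v)"
  by (simp add: divpow_def rep_scale_right del: of_nat_Suc)

lemma divpow_eq_0: "(\<rho> x ^^ K) v = 0 \<Longrightarrow> K \<le> k \<Longrightarrow> divpow x k v = 0"
  using funpow_zero_mono[of "\<rho> x" K v k] by (simp add: divpow_def)

text \<open>This is exp(\<rho>(s)) v. Summing over the nonzero terms avoids the choice of a
  nilpotency exponent; with infinitely many nonzero terms the sum defaults to 0.\<close>

definition rep_exp :: "'g \<Rightarrow> 'v \<Rightarrow> 'v" where
  "rep_exp s v = (\<Sum>k | divpow s k v \<noteq> 0. divpow s k v)"

lemma rep_exp_eq: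
  assumes "(\<rho> s ^^ K) v = 0"
  shows "rep_exp s v = (\<Sum>k<K. divpow s k v)"
  unfolding rep_exp_def
proof (rule sum.mono_neutral_left)
  show "{k. divpow s k v \<noteq> 0} \<subseteq> {..<K}"
    using divpow_eq_0[OF assms] by (metis (mono_tags, lifting) lessThan_iff mem_Collect_eq not_le subsetI)
qed auto

end

text \<open>The commutator law for ad is the Jacobi identity. Everything proved in
  \<open>lie_rep\<close> thereby holds for the adjoint action too.\<close>

lemma (in lie_algebra) lie_rep_adjoint: "lie_rep scale bracket scale bracket"
proof
  fix x y v
  show "bracket (bracket x y) v = bracket x (bracket y v) - bracket y (bracket x v)"
    using jacobi[of x y v] bracket_flip[of v "bracket x y"] bracket_flip[of v x]
      lie_algebra.bracket_sum_right[OF lie_algebra_axioms, of y "\<lambda>_. - bracket x v" "{()}"]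
      bracket_scale_right[of y "- 1" "bracket x v"]
    by (simp add: algebra_simps)
qed (simp_all add: bracket_add_left bracket_add_right bracket_scale_left bracket_scale_right)

section \<open>Conjugation by exponentials of locally nilpotent elements\<close>

context lie_rep
begin

interpretation adj: lie_rep scale bracket scale bracket
  by (rule lie_rep_adjoint)

text \<open>Applying \<rho>(s) to the identity for k raises either the index a or the index k - a.
  The term with index a is then weighted by a and by k + 1 - a, in total k + 1, and this factor
  cancels.\<close>

lemma divpow_leibniz:
  "divpow s k (\<rho> x v) = (\<Sum>a\<le>k. \<rho> (adj.divpow s a x) (divpow s (k - a) v))"
proof (induction k)
  case 0
  show ?case by (simp add: divpow_def adj.divpow_def)
next
  case (Suc k)
  let ?D = "\<lambda>a. adj.divpow s a x" and ?P = "\<lambda>a. divpow s a v"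
  have "scaleV (of_nat (Suc k)) (divpow s (Suc k) (\<rho> x v)) = \<rho> s (\<Sum>a\<le>k. \<rho> (?D a) (?P (k - a)))"
    by (simp only: divpow_Suc[symmetric] Suc)
  also have "\<dots> = (\<Sum>a\<le>k. \<rho> (?D a) (\<rho> s (?P (k - a))) + \<rho> (bracket s (?D a)) (?P (k - a)))"
    unfolding rep_sum by (intro sum.cong refl) (simp add: rep_bracket)
  also have "\<dots> = (\<Sum>a\<le>k. scaleV (of_nat (Suc k - a)) (\<rho> (?D a) (?P (Suc k - a)))) +
      (\<Sum>a\<le>k. scaleV (of_nat (Suc a)) (\<rho> (?D (Suc a)) (?P (Suc k - Suc a))))"
    unfolding sum.distrib
    by (intro arg_cong2[where f = "(+)"] sum.cong refl)
      (simp_all add: divpow_Suc adj.divpow_Suc rep_scale_left rep_scale_right Suc_diff_le del: of_nat_Suc)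
  \<comment> \<open>The added term a = k + 1 has coefficient 0; in the next step the index is
    shifted and the added term a = 0 vanishes likewise.\<close>
  also have "(\<Sum>a\<le>k. scaleV (of_nat (Suc k - a)) (\<rho> (?D a) (?P (Suc k - a))))
      = (\<Sum>a\<le>Suc k. scaleV (of_nat (Suc k - a)) (\<rho> (?D a) (?P (Suc k - a))))"
    by simp
  also have "(\<Sum>a\<le>k. scaleV (of_nat (Suc a)) (\<rho> (?D (Suc a)) (?P (Suc k - Suc a))))
      = (\<Sum>a\<le>Suc k. scaleV (of_nat a) (\<rho> (?D a) (?P (Suc k - a))))"
    by (subst sum.atMost_Suc_shift) simp
  also have "(\<Sum>a\<le>Suc k. scaleV (of_nat (Suc k - a)) (\<rho> (?D a) (?P (Suc k - a)))) + \<dots>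
      = scaleV (of_nat (Suc k)) (\<Sum>a\<le>Suc k. \<rho> (?D a) (?P (Suc k - a)))"
    unfolding V.scale_sum_right sum.distrib[symmetric] V.scale_left_distrib[symmetric] of_nat_add[symmetric]
    by (intro sum.cong refl) simp
  finally show ?case
    by (metis V.scale_left_imp_eq of_nat_eq_0_iff nat.distinct(1))
qed

text \<open>Summed over k, the Leibniz rule regroups the product of two finite exponential series
  along the antidiagonals a + b = k.\<close>

lemma rep_exp_intertwines:
  assumes A: "(bracket s ^^ A) x = 0" and B: "(\<rho> s ^^ B) v = 0"
  shows "\<rho> (adj.rep_exp s x) (rep_exp s v) = rep_exp s (\<rho> x v)"
proof -
  let ?g = "\<lambda>a b. \<rho> (adj.divpow s a x) (divpow s b v)"
  have zero: "?g a b = 0" if "a \<ge> A \<or> b \<ge> B" for a b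
    using that divpow_eq_0[OF B] adj.divpow_eq_0[OF A] by auto
  have dp: "divpow s k (\<rho> x v) = (\<Sum>a\<le>k. ?g a (k - a))" for k
    by (rule divpow_leibniz)
  \<comment> \<open>If a + b = A + B, then a is at least A or b is at least B; hence A + B terms
    suffice for the series on \<open>\<rho> x v\<close>.\<close>
  have "divpow s (A + B) (\<rho> x v) = 0"
    unfolding dp by (intro sum.neutral ballI zero) auto
  then have "(\<rho> s ^^ (A + B)) (\<rho> x v) = 0" by (simp add: divpow_def)
  then have "rep_exp s (\<rho> x v) = (\<Sum>k<A + B. \<Sum>a\<le>k. ?g a (k - a))"
    by (simp add: rep_exp_eq dp)
  also have "\<dots> = (\<Sum>(a, b) | a + b < A + B. ?g a b)"
    by (rule sum.triangle_reindex[symmetric])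
  \<comment> \<open>The triangle contains the rectangle, and every term outside the rectangle is
    zero.\<close>
  also have "\<dots> = (\<Sum>(a, b)\<in>{..<A} \<times> {..<B}. ?g a b)"
  proof (rule sum.mono_neutral_right)
    show "finite {(a, b). a + b < A + B}"
      by (rule finite_subset[of _ "{..A + B} \<times> {..A + B}"]) auto
    show "\<forall>p\<in>{(a, b). a + b < A + B} - {..<A} \<times> {..<B}. (case p of (a, b) \<Rightarrow> ?g a b) = 0"
      by (auto simp: not_less intro!: zero)
  qed auto
  also have "\<dots> = \<rho> (adj.rep_exp s x) (rep_exp s v)"
    by (simp add: rep_exp_eq[OF B] adj.rep_exp_eq[OF A] rep_sum sum.cartesian_product)
      (simp add: sum.swap[of _ "{..<A}"] sum.cartesian_product[symmetric])
  finally show ?thesis by simp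
qed

text \<open>By intertwining, powers of \<rho>(exp(ad s) x) send exp(s) v to exp(s) \<rho>(x)^k v,
  which is eventually zero. It remains to pass from vectors of the form exp(s) v to all
  vectors.\<close>

lemma locally_nilpotent_exp:
  assumes s: "locally_nilpotent (\<rho> s)" "locally_nilpotent (bracket s)"
    and x: "locally_nilpotent (\<rho> x)"
  shows "locally_nilpotent (\<rho> (adj.rep_exp s x))"
proof -
  let ?y = "adj.rep_exp s x"
  have "\<rho> ?y (rep_exp s v) = rep_exp s (\<rho> x v)" for v
    using s rep_exp_intertwines unfolding locally_nilpotent_def by metis
  then have pow: "(\<rho> ?y ^^ k) (rep_exp s v) = rep_exp s ((\<rho> x ^^ k) v)" for k v
    by (induction k) simp_all
  have E: "\<exists>k. (\<rho> ?y ^^ k) (rep_exp s v) = 0" for v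
    using x rep_exp_eq[of 0 s 0] unfolding locally_nilpotent_def pow by (metis funpow_0 lessThan_0 sum.empty)
  \<comment> \<open>\<open>rep_exp s\<close> is unipotent, which replaces the use of its inverse.\<close>
  have "\<exists>k. (\<rho> ?y ^^ k) v = 0" if "(\<rho> s ^^ B) v = 0" for B v
    using that
  proof (induction B arbitrary: v)
    case (Suc B)
    \<comment> \<open>The vector v equals exp(s) v minus the terms with k at least 1. These are
      killed by one power of \<rho>(s) fewer, so the induction hypothesis covers them.\<close>
    have "(\<rho> s ^^ B) (divpow s k v) = 0" if "k \<in> {1..<Suc B}" for k
    proof -
      have "(\<rho> s ^^ B) ((\<rho> s ^^ k) v) = (\<rho> s ^^ (B + k)) v"
        by (simp add: funpow_add)
      also have "\<dots> = 0"
        using that by (intro funpow_zero_mono[OF _ Suc.prems]) auto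
      finally show ?thesis by (simp add: divpow_def rep_pow_linear)
    qed
    then have "(\<Sum>k\<in>{1..<Suc B}. divpow s k v) \<in> {v. \<exists>k. (\<rho> ?y ^^ k) v = 0}"
      by (intro V.subspace_sum subspace_rep_nilpotent) (use Suc.IH in blast)
    then have "rep_exp s v - (\<Sum>k\<in>{1..<Suc B}. divpow s k v) \<in> {v. \<exists>k. (\<rho> ?y ^^ k) v = 0}"
      using E by (intro V.subspace_diff subspace_rep_nilpotent) auto
    also have "rep_exp s v - (\<Sum>k\<in>{1..<Suc B}. divpow s k v) = v"
      unfolding rep_exp_eq[OF Suc.prems] lessThan_atLeast0
      by (subst sum.atLeast_Suc_lessThan) (simp_all add: divpow_def)
    finally show ?case by simp
  qed auto
  with s(1) show ?thesis unfolding locally_nilpotent_def by blast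
qed

end

section \<open>The subalgebra spanned by the good elements\<close>

context lie_rep
begin

interpretation adj: lie_rep scale bracket scale bracket
  by (rule lie_rep_adjoint)

text \<open>In each Leibniz term of order a + b one of the two factors vanishes. In a cyclic module
  this reduces local nilpotency to a check on the generator.\<close>

lemma rep_nilpotent_act:
  assumes "(bracket s ^^ a) x = 0" "(\<rho> s ^^ b) v = 0"
  shows "\<exists>k. (\<rho> s ^^ k) (\<rho> x v) = 0"
proof -
  have "\<rho> (adj.divpow s i x) (divpow s (a + b - i) v) = 0" for i
    using divpow_eq_0[OF assms(2), of "a + b - i"] adj.divpow_eq_0[OF assms(1), of i]
    by (cases "i < a") auto
  then have "divpow s (a + b) (\<rho> x v) = 0"
    by (simp add: divpow_leibniz)
  then show ?thesis by (auto simp: divpow_def)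
qed

definition good :: "'g set" where
  "good = {x. locally_nilpotent (bracket x) \<and> locally_nilpotent (\<rho> x)}"

text \<open>For every scalar c the element exp(c ad s) x is good. As a polynomial in c it takes
  values in \<open>span good\<close>, and its coefficient of c is [s, x].\<close>

lemma bracket_good_in_span:
  assumes s: "s \<in> good" and x: "x \<in> good"
  shows "bracket s x \<in> span good"
proof -
  from s obtain A where A: "(bracket s ^^ A) x = 0"
    unfolding good_def locally_nilpotent_def by blast
  \<comment> \<open>Adding 2 ensures that the sum has a term with index 1 even when the original
    exponent is 0.\<close>
  then have A: "(bracket s ^^ (A + 2)) x = 0"
    using funpow_zero_mono[of "bracket s" A x "A + 2"] by simp
  have "(\<Sum>k<A + 2. scale (c ^ k) (adj.divpow s k x)) \<in> span good" for c
  proof -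
    have "(bracket (scale c s) ^^ (A + 2)) x = 0"
      by (simp only: adj.rep_pow_linear A scale_zero_right)
    then have "adj.rep_exp (scale c s) x = (\<Sum>k<A + 2. adj.divpow (scale c s) k x)"
      by (rule adj.rep_exp_eq)
    also have "\<dots> = (\<Sum>k<A + 2. scale (c ^ k) (adj.divpow s k x))"
      by (simp only: adj.divpow_def adj.rep_pow_linear scale_scale mult.commute)
    finally have "adj.rep_exp (scale c s) x = \<dots>" .
    moreover have "adj.rep_exp (scale c s) x \<in> good"
      using s x locally_nilpotent_exp adj.locally_nilpotent_exp locally_nilpotent_scale
        adj.locally_nilpotent_scale unfolding good_def by blast
    ultimately show ?thesis by (metis span_base)
  qed
  from subspace_polynomial_coeffs[OF subspace_span this, of 1]
  show ?thesis by (simp add: adj.divpow_def)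
qed

lemma span_good_subalgebra:
  assumes "x \<in> span good" "y \<in> span good"
  shows "bracket x y \<in> span good"
proof -
  have *: "bracket s y \<in> span good" if "s \<in> good" for s
    using assms(2)
  proof (induction y rule: span_induct_alt)
    case (step c x y)
    then show ?case
      using bracket_good_in_span[OF that] by (auto simp: bracket_add_right bracket_scale_right
          intro!: span_add span_scale)
  qed (simp add: span_zero)
  show ?thesis using assms(1)
  proof (induction x rule: span_induct_alt)
    case (step c x z)
    then show ?case
      using * by (auto simp: bracket_add_left bracket_scale_left intro!: span_add span_scale)
  qed (simp add: span_zero)
qed

section \<open>Straightening of words, as in the spanning half of the Poincare-Birkhoff-Witt
  theorem\<close>

text \<open>Words are lists of indices rather than of elements, so that they can be sorted.\<close>

definition rep_word :: "(nat \<Rightarrow> 'g) \<Rightarrow> nat list \<Rightarrow> 'v \<Rightarrow> 'v" where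
  "rep_word y ws v = foldr (\<lambda>i. \<rho> (y i)) ws v"

lemma rep_word_simps [simp]:
  "rep_word y [] v = v" "rep_word y (i # ws) v = \<rho> (y i) (rep_word y ws v)"
  by (simp_all add: rep_word_def)

definition word_filtration :: "(nat \<Rightarrow> 'g) \<Rightarrow> nat \<Rightarrow> 'v \<Rightarrow> nat \<Rightarrow> 'v set" where
  "word_filtration y M v k = V.span {rep_word y ws v | ws. set ws \<subseteq> {..<M} \<and> length ws \<le> k}"

lemma rep_word_in_filtration:
  "set ws \<subseteq> {..<M} \<Longrightarrow> length ws \<le> k \<Longrightarrow> rep_word y ws v \<in> word_filtration y M v k"
  unfolding word_filtration_def by (rule V.span_base) auto

text \<open>A sorted word starts with a block of its smallest index, that is, with a power of one
  operator, which takes only finitely many values on a given vector. The induction runs downward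
  from the empty index range; what is finite is the set of resulting vectors, not of words.\<close>

lemma finite_sorted_words:
  assumes nil: "\<And>i. i < M \<Longrightarrow> locally_nilpotent (\<rho> (y i))"
  shows "finite {rep_word y ws v | ws. sorted ws \<and> set ws \<subseteq> {..<M}}"
proof -
  have "finite {rep_word y ws v | ws. sorted ws \<and> set ws \<subseteq> {m..<M}}" if "m \<le> M" for m
    using that
  proof (induction rule: inc_induct)
    case base
    show ?case by simp
  next
    case (step m)
    let ?Z = "\<lambda>m. {rep_word y ws v | ws. sorted ws \<and> set ws \<subseteq> {m..<M}}"
    have "finite (range (\<lambda>a. (\<rho> (y m) ^^ a) u))" for u
    proof -
      obtain k where k: "(\<rho> (y m) ^^ k) u = 0"
        using nil[OF step(2)] unfolding locally_nilpotent_def by blast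
      have "(\<rho> (y m) ^^ a) u \<in> (\<lambda>a. (\<rho> (y m) ^^ a) u) ` {..k}" for a
      proof (cases "a \<le> k")
        case False
        then have "(\<rho> (y m) ^^ a) u = (\<rho> (y m) ^^ k) u"
          using funpow_zero_mono[OF _ k, of a] k by simp
        then show ?thesis by blast
      qed auto
      then have "range (\<lambda>a. (\<rho> (y m) ^^ a) u) \<subseteq> (\<lambda>a. (\<rho> (y m) ^^ a) u) ` {..k}" by blast
      then show ?thesis by (rule finite_subset) simp
    qed
    moreover have "?Z m \<subseteq> (\<Union>u\<in>?Z (Suc m). range (\<lambda>a. (\<rho> (y m) ^^ a) u))"
    proof clarify
      fix ws :: "nat list"
      assume "sorted ws" "set ws \<subseteq> {m..<M}"
      then show "rep_word y ws v \<in> (\<Union>u\<in>?Z (Suc m). range (\<lambda>a. (\<rho> (y m) ^^ a) u))"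
      proof (induction ws)
        case Nil
        have "rep_word y [] v \<in> ?Z (Suc m)" by (intro CollectI exI[of _ "[]"]) auto
        moreover have "rep_word y [] v = (\<rho> (y m) ^^ 0) (rep_word y [] v)" by simp
        ultimately show ?case by blast
      next
        case (Cons i ws)
        show ?case
        proof (cases "i = m")
          case True
          from Cons obtain u a where "u \<in> ?Z (Suc m)" "rep_word y ws v = (\<rho> (y m) ^^ a) u"
            by auto
          moreover from this have "rep_word y (i # ws) v = (\<rho> (y m) ^^ Suc a) u"
            using True by simp
          ultimately show ?thesis by blast
        next
          case False
          with Cons.prems have "set (i # ws) \<subseteq> {Suc m..<M}" by fastforce
          with Cons.prems(1) have "rep_word y (i # ws) v \<in> ?Z (Suc m)" by blast
          moreover have "rep_word y (i # ws) v = (\<rho> (y m) ^^ 0) (rep_word y (i # ws) v)" by simp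
          ultimately show ?thesis by blast
        qed
      qed
    qed
    ultimately show ?case using step(3) by (meson finite_UN_I finite_subset)
  qed
  from this[of 0] show ?thesis by (simp add: atLeast0LessThan)
qed

context
  fixes y :: "nat \<Rightarrow> 'g" and M :: nat
  assumes spanning: "\<And>x. \<exists>z\<in>span (y ` {..<M}). \<forall>w. \<rho> x w = \<rho> z w"
begin

text \<open>The family \<open>y\<close> need not span the Lie algebra, only its image among the
  operators: \<open>x\<close> is replaced by a combination \<open>z\<close> of the
  \<open>y i\<close> with the same action. This matters for current algebras, which are
  infinite-dimensional.\<close>

lemma rep_word_filtration:
  assumes "w \<in> word_filtration y M v k"
  shows "\<rho> x w \<in> word_filtration y M v (Suc k)"
proof -
  have *: "\<rho> (y i) w \<in> word_filtration y M v (Suc k)" if i: "i < M" for i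
    using assms unfolding word_filtration_def[of _ _ _ k]
  proof (induction w rule: V.span_induct_alt)
    case base
    show ?case by (simp add: word_filtration_def V.span_zero)
  next
    case (step c x w)
    then obtain ws where ws: "x = rep_word y ws v" "set ws \<subseteq> {..<M}" "length ws \<le> k" by blast
    have "rep_word y (i # ws) v \<in> word_filtration y M v (Suc k)"
      using ws i by (intro rep_word_in_filtration) auto
    with step(2) show ?case
      by (auto simp: rep_add_right rep_scale_right ws(1) word_filtration_def
          intro!: V.span_add V.span_scale)
  qed
  obtain z where "z \<in> span (y ` {..<M})" and z: "\<rho> x w = \<rho> z w"
    using spanning by blast
  from this(1) have "\<rho> z w \<in> word_filtration y M v (Suc k)"
  proof (induction z rule: span_induct_alt)
    case (step c x z)
    then show ?case using *
      by (auto simp: rep_add_left rep_scale_left word_filtration_def intro!: V.span_add V.span_scale)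
  qed (simp add: word_filtration_def V.span_zero)
  then show ?thesis by (simp add: z)
qed

text \<open>Moving \<open>i\<close> past a letter \<open>j\<close> costs the bracket of
  \<open>y i\<close> and \<open>y j\<close>, which acts on a word shorter by two letters and so
  contributes one degree less.\<close>

lemma rep_word_insort:
  assumes "i < M" "set ws \<subseteq> {..<M}"
  shows "rep_word y (i # ws) v - rep_word y (insort i ws) v \<in> word_filtration y M v (length ws)"
  using assms(2)
proof (induction ws)
  case (Cons j ws)
  let ?w = "\<lambda>ws. rep_word y ws v"
  have "?w (i # j # ws) - ?w (j # insort i ws)
      = \<rho> (y j) (?w (i # ws) - ?w (insort i ws)) + \<rho> (bracket (y i) (y j)) (?w ws)"
    by (simp add: rep_diff rep_bracket)
  also have "\<dots> \<in> word_filtration y M v (length (j # ws))"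
    using Cons rep_word_filtration[OF rep_word_in_filtration[of ws M "length ws" y v]]
      rep_word_filtration[of "?w (i # ws) - ?w (insort i ws)" v "length ws"]
    by (auto simp: word_filtration_def intro!: V.span_add)
  finally show ?case by (auto simp: word_filtration_def V.span_zero)
qed (simp add: word_filtration_def V.span_zero)

text \<open>Insertion sort, with every exchange made modulo shorter words. For the empty word the
  truncated bound 0 is harmless, as the difference is 0.\<close>

lemma rep_word_sort:
  assumes "set ws \<subseteq> {..<M}"
  shows "rep_word y ws v - rep_word y (sort ws) v \<in> word_filtration y M v (length ws - 1)"
  using assms
proof (induction ws)
  case (Cons i ws)
  let ?w = "\<lambda>ws. rep_word y ws v"
  have "\<rho> (y i) (?w ws - ?w (sort ws)) \<in> word_filtration y M v (length ws)"
  proof (cases ws)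
    case (Cons j us)
    then show ?thesis
      using Cons.IH Cons.prems rep_word_filtration[of "?w ws - ?w (sort ws)" v "length ws - 1" "y i"]
      by simp
  qed (simp add: word_filtration_def V.span_zero)
  moreover have "?w (i # sort ws) - ?w (insort i (sort ws)) \<in> word_filtration y M v (length ws)"
    using rep_word_insort[of i "sort ws" v] Cons.prems by simp
  ultimately have "\<rho> (y i) (?w ws - ?w (sort ws)) + (?w (i # sort ws) - ?w (insort i (sort ws)))
      \<in> word_filtration y M v (length ws)"
    unfolding word_filtration_def by (rule V.span_add)
  also have "\<rho> (y i) (?w ws - ?w (sort ws)) + (?w (i # sort ws) - ?w (insort i (sort ws)))
      = ?w (i # ws) - ?w (sort (i # ws))"
    by (simp add: rep_diff)
  finally show ?case by simp
qed (simp add: word_filtration_def V.span_zero)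

text \<open>A word of length at most k + 1 equals its sorted form modulo words of length at most k,
  which the induction hypothesis handles.\<close>

lemma word_filtration_le_sorted:
  "word_filtration y M v k \<subseteq> V.span {rep_word y ws v | ws. sorted ws \<and> set ws \<subseteq> {..<M}}"
    (is "_ \<subseteq> V.span ?O")
proof (induction k)
  case 0
  show ?case unfolding word_filtration_def by (rule V.span_mono) (auto intro!: exI[of _ "[]"])
next
  case (Suc k)
  have "rep_word y ws v \<in> V.span ?O" if ws: "set ws \<subseteq> {..<M}" "length ws \<le> Suc k" for ws
  proof -
    have "rep_word y ws v - rep_word y (sort ws) v \<in> word_filtration y M v k"
    proof -
      have "word_filtration y M v (length ws - 1) \<subseteq> word_filtration y M v k"
        unfolding word_filtration_def
      proof (rule V.span_mono, clarify)
        fix us :: "nat list" assume "set us \<subseteq> {..<M}" "length us \<le> length ws - 1"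
        with ws(2) have "set us \<subseteq> {..<M} \<and> length us \<le> k" by simp
        then show "\<exists>ws. rep_word y us v = rep_word y ws v \<and> set ws \<subseteq> {..<M} \<and> length ws \<le> k"
          by blast
      qed
      then show ?thesis using rep_word_sort[OF ws(1)] by blast
    qed
    moreover have "rep_word y (sort ws) v \<in> V.span ?O"
      using ws(1) by (intro V.span_base CollectI exI[of _ "sort ws"]) simp
    ultimately show ?thesis
      using Suc V.span_add[of "rep_word y ws v - rep_word y (sort ws) v" ?O "rep_word y (sort ws) v"]
      by (simp add: subset_iff)
  qed
  then show ?case
    unfolding word_filtration_def by (intro V.span_minimal V.subspace_span) auto
qed

end

text \<open>Since \<open>span good\<close> is a subalgebra containing \<open>S\<close>, it is
  everything, so the finite set \<open>B\<close> lies in the span of finitely many good elements.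
  Sorted words in these, applied to \<open>v\<close>, give finitely many vectors, whose span is
  invariant by straightening.\<close>

theorem finite_dimensional_cyclic_submodule:
  assumes S: "S \<subseteq> good"
    and generates: "\<And>M. subspace M \<Longrightarrow> S \<subseteq> M \<Longrightarrow>
      (\<And>x y. x \<in> M \<Longrightarrow> y \<in> M \<Longrightarrow> bracket x y \<in> M) \<Longrightarrow> M = UNIV"
    and fin: "finite B" and B: "\<And>x. \<exists>z\<in>span B. \<forall>w. \<rho> x w = \<rho> z w"
  shows "\<exists>C. finite C \<and> v \<in> V.span C \<and> (\<forall>x. \<forall>w\<in>V.span C. \<rho> x w \<in> V.span C)"
proof -
  have "span good = UNIV"
  proof (rule generates)
    show "S \<subseteq> span good" using S span_superset by blast
  qed (simp_all add: span_good_subalgebra)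
  have "\<exists>t. finite t \<and> t \<subseteq> good \<and> b \<in> span t" for b
  proof -
    have "b \<in> span good" by (simp add: \<open>span good = UNIV\<close>)
    then obtain t r where "finite t" "t \<subseteq> good" "b = (\<Sum>a\<in>t. scale (r a) a)"
      unfolding span_explicit by blast
    moreover from this have "b \<in> span t" by (simp add: span_sum span_scale span_base)
    ultimately show ?thesis by blast
  qed
  then obtain t where t: "\<And>b. finite (t b)" "\<And>b. t b \<subseteq> good" "\<And>b. b \<in> span (t b)" by metis
  define T where "T = (\<Union>b\<in>B. t b)"
  have "finite T" using fin t(1) by (simp add: T_def)
  then obtain y :: "nat \<Rightarrow> 'g" and M where T: "T = y ` {..<M}"
    by (metis finite_imp_nat_seg_image_inj_on lessThan_def)
  have "B \<subseteq> span T"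
    using t(3) span_mono[of "t _" T] unfolding T_def by blast
  then have "span B \<subseteq> span T" by (simp add: span_minimal)
  then have spanning: "\<exists>z\<in>span (y ` {..<M}). \<forall>w. \<rho> x w = \<rho> z w" for x
    using B[of x] unfolding T by blast
  have good_y: "locally_nilpotent (\<rho> (y i))" if "i < M" for i
  proof -
    have "y i \<in> T" using that T by blast
    then show ?thesis using t(2) by (auto simp: T_def good_def)
  qed
  let ?O = "{rep_word y ws v | ws. sorted ws \<and> set ws \<subseteq> {..<M}}"
  have "\<rho> x w \<in> V.span ?O" if "w \<in> V.span ?O" for x w
    using that
  proof (induction w rule: V.span_induct_alt)
    case (step c u w)
    then obtain ws where ws: "u = rep_word y ws v" "set ws \<subseteq> {..<M}" by blast
    then have "\<rho> x u \<in> word_filtration y M v (Suc (length ws))"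
      using rep_word_filtration[OF spanning] rep_word_in_filtration by simp
    then have "\<rho> x u \<in> V.span ?O"
      using word_filtration_le_sorted[OF spanning] by blast
    with step(2) show ?case
      by (auto simp: rep_add_right rep_scale_right intro!: V.span_add V.span_scale)
  qed (simp add: V.span_zero)
  moreover have "v \<in> V.span ?O"
    by (rule V.span_base, intro CollectI exI[of _ "[]"]) simp
  moreover have "finite ?O" using finite_sorted_words good_y by blast
  ultimately show ?thesis by blast
qed

end

section \<open>Finite-dimensional presented modules\<close>

text \<open>A basis of \<open>N\<close> is extended to the whole space; its elements are sent to 0
  and the new basis vectors are fixed. The map lets a quotient by \<open>N\<close> be modelled on
  the original type.\<close>

lemma (in vector_space) exists_projection_along:
  assumes N: "subspace N"
  shows "\<exists>\<pi>. Vector_Spaces.linear scale scale \<pi> \<and> (\<forall>x\<in>N. \<pi> x = 0) \<and> (\<forall>x. x - \<pi> x \<in> N)"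
proof -
  interpret vector_space_pair scale scale by unfold_locales
  obtain B where B: "B \<subseteq> N" "independent B" "N \<subseteq> span B"
    using maximal_independent_subset by blast
  obtain C where C: "B \<subseteq> C" "independent C" "UNIV \<subseteq> span C"
    by (rule maximal_independent_subset_extend[OF subset_UNIV B(2)])
  obtain g where g: "Vector_Spaces.linear scale scale g" "\<forall>x\<in>C. g x = (if x \<in> B then 0 else x)"
    using linear_independent_extend[OF C(2), of "\<lambda>x. if x \<in> B then 0 else x"] by blast
  interpret g: Vector_Spaces.linear scale scale g by (rule g(1))
  have "g x = 0" if "x \<in> span B" for x
    using that
  proof (induction x rule: span_induct_alt)
    case (step c x y)
    then show ?case using g(2) C(1) by (auto simp: g.add g.scale)
  qed (simp add: g.zero)
  moreover have "x - g x \<in> N" for x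
  proof -
    have "x \<in> span C" using C(3) by blast
    then show ?thesis
    proof (induction x rule: span_induct_alt)
      case (step c x y)
      have "x - g x \<in> N" using g(2) step(1) B(1) N by (auto simp: subspace_0)
      then have "scale c (x - g x) + (y - g y) \<in> N"
        using N step(2) by (intro subspace_add subspace_scale)
      then show ?case by (simp add: g.add g.scale scale_right_diff_distrib algebra_simps)
    qed (simp add: g.zero subspace_0 N)
  qed
  ultimately show ?thesis using g(1) B(3) by blast
qed

lemma vector_space_free_algebra: "vector_space (\<lambda>c (p :: 'l free_algebra). scalar c * p)"
  by unfold_locales (simp_all add: scalar_simps algebra_simps)

text \<open>Left multiplication by generators builds every word from the empty one.\<close>

lemma free_algebra_generated:
  fixes W :: "'l free_algebra set"
  assumes "1 \<in> W" "\<And>p q. p \<in> W \<Longrightarrow> q \<in> W \<Longrightarrow> p + q \<in> W"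
    and "\<And>c p. p \<in> W \<Longrightarrow> scalar c * p \<in> W" "\<And>x p. p \<in> W \<Longrightarrow> generator x * p \<in> W"
  shows "p \<in> W"
proof (induction p rule: free_algebra_induct)
  case (single k c)
  have word: "Poly_Mapping.single (Word xs) 1 \<in> W" for xs
  proof (induction xs)
    case Nil
    then show ?case using assms(1) by (simp add: zero_free_monoid_def[symmetric])
  next
    case (Cons x xs)
    have "generator x * Poly_Mapping.single (Word xs) 1 = Poly_Mapping.single (Word (x # xs)) 1"
      by (simp add: generator_def mult_single plus_free_monoid_def)
    then show ?case using assms(4)[OF Cons, of x] by simp
  qed
  have "scalar c * Poly_Mapping.single (Word (letters k)) 1 = Poly_Mapping.single k c"
    by (simp add: scalar_def mult_single)
  then show ?case using assms(3)[OF word, of c "letters k"] by simp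
qed (use assms(2) in blast)

context
  fixes scale :: "complex \<Rightarrow> 'l::ab_group_add \<Rightarrow> 'l"
    and bracket :: "'l \<Rightarrow> 'l \<Rightarrow> 'l"
    and R :: "'l free_algebra set"
begin

private abbreviation "N \<equiv> relation_ideal scale bracket R"
private abbreviation "scaleA \<equiv> (\<lambda>c (p :: 'l free_algebra). scalar c * p)"

interpretation A: vector_space scaleA
  by (rule vector_space_free_algebra)

lemma relation_ideal_closed:
  "0 \<in> N" "p \<in> N \<Longrightarrow> q \<in> N \<Longrightarrow> p + q \<in> N" "p \<in> N \<Longrightarrow> a * p \<in> N"
  "p \<in> N \<Longrightarrow> q \<in> N \<Longrightarrow> p - q \<in> N" "r \<in> R \<Longrightarrow> r \<in> N"
proof -
  show *: "0 \<in> N" "p \<in> N \<Longrightarrow> q \<in> N \<Longrightarrow> p + q \<in> N" "p \<in> N \<Longrightarrow> a * p \<in> N" for p q a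
    using left_ideal_relation_ideal[of scale bracket R] unfolding left_ideal_def by blast+
  show "p - q \<in> N" if "p \<in> N" "q \<in> N"
    using *(2)[OF that(1) *(3)[OF that(2), of "- 1"]] by simp
  show "r \<in> R \<Longrightarrow> r \<in> N" by (simp add: relation_ideal_def hull_inc)
qed

lemma subspace_relation_ideal: "A.subspace N"
  by (auto intro!: A.subspaceI relation_ideal_closed(1-3))

lemma generator_relations:
  "(generator (x + y) - generator x - generator y) * p \<in> N"
  "(generator (scale c x) - scalar c * generator x) * p \<in> N"
  "(generator x * generator y - generator y * generator x - generator (bracket x y)) * p \<in> N"
  by (intro enveloping_ideal_mult enveloping_relations_in)+

text \<open>The elements of the Lie algebra that kill the cyclic vector, the coset of 1, form a Lie
  subalgebra. For brackets, both products of the two generators lie in \<open>N\<close> because it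
  is a left ideal.\<close>

lemma generator_in_relation_ideal:
  "generator x \<in> N \<Longrightarrow> generator y \<in> N \<Longrightarrow> generator (x + y) \<in> N"
  "generator x \<in> N \<Longrightarrow> generator (scale c x) \<in> N"
  "generator x \<in> N \<Longrightarrow> generator y \<in> N \<Longrightarrow> generator (bracket x y) \<in> N"
proof -
  show "generator (x + y) \<in> N" if "generator x \<in> N" "generator y \<in> N"
    using relation_ideal_closed(2)[OF relation_ideal_closed(2)[OF generator_relations(1)[of x y 1] that(1)] that(2)]
    by simp
  show "generator (scale c x) \<in> N" if "generator x \<in> N"
    using relation_ideal_closed(2)[OF generator_relations(2)[of c x 1] relation_ideal_closed(3)[OF that, of "scalar c"]]
    by simp
  show "generator (bracket x y) \<in> N" if "generator x \<in> N" "generator y \<in> N"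
    using relation_ideal_closed(4)[OF relation_ideal_closed(4)[OF
        relation_ideal_closed(3)[OF that(2), of "generator x"]
        relation_ideal_closed(3)[OF that(1), of "generator y"]]
        generator_relations(3)[of x y 1]]
    by simp
qed

lemma finite_dimensional_module_if_span:
  assumes fin: "finite C" and span: "\<And>p. \<exists>q\<in>A.span C. p - q \<in> N"
  shows "finite_dimensional_module (presented_module scale bracket R)"
proof -
  let ?M = "presented_module scale bracket R"
  interpret M: Module.module complex_ring ?M by (rule module_presented_module)
  \<comment> \<open>Different elements of \<open>C\<close> may have the same coset; \<open>D\<close>
    keeps one representative of each, so that sums over cosets can be reindexed.\<close>
  obtain D where D: "D \<subseteq> C" "inj_on (coset N) D" "coset N ` C = coset N ` D"
    by (metis subset_image_inj subset_refl)
  have fD: "finite D" using D(1) fin finite_subset by blast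
  have coset_finsum: "coset N (\<Sum>b\<in>D. scalar (u b) * b) = (\<Oplus>\<^bsub>?M\<^esub>b\<in>D. u b \<odot>\<^bsub>?M\<^esub> coset N b)" for u
    using fD
  proof (induction D)
    case empty
    show ?case by (simp add: presented_module_simps)
  next
    case (insert b D)
    have "coset N (\<Sum>b\<in>insert b D. scalar (u b) * b)
        = coset N (scalar (u b) * b) \<oplus>\<^bsub>?M\<^esub> coset N (\<Sum>b\<in>D. scalar (u b) * b)"
      using insert(1,2) by (simp add: presented_module_simps)
    also have "\<dots> = (\<Oplus>\<^bsub>?M\<^esub>b\<in>insert b D. u b \<odot>\<^bsub>?M\<^esub> coset N b)"
      unfolding insert.IH using insert(1,2)
      by (subst M.finsum_insert) (auto simp: presented_module_simps(1,4))
    finally show ?case .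
  qed
  have "\<exists>c. v = (\<Oplus>\<^bsub>?M\<^esub>b\<in>coset N ` D. c b \<odot>\<^bsub>?M\<^esub> b)" if v: "v \<in> carrier ?M" for v
  proof -
    obtain p where p: "v = coset N p" using v by (auto simp: presented_module_simps)
    have "\<exists>q\<in>A.span D. r - q \<in> N" if "r \<in> A.span C" for r
      using that
    proof (induction r rule: A.span_induct_alt)
      case base
      show ?case using A.span_zero relation_ideal_closed(1) by force
    next
      case (step c x r)
      obtain d where d: "d \<in> D" "coset N x = coset N d" using step(1) D(3) by blast
      then have cd: "scalar c * (x - d) \<in> N"
        using coset_eq_iff[OF left_ideal_relation_ideal] relation_ideal_closed(3) by blast
      obtain q where q: "q \<in> A.span D" "r - q \<in> N" using step(2) by blast
      from cd q(2) have "scalar c * (x - d) + (r - q) \<in> N" by (rule relation_ideal_closed(2))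
      then have "(scalar c * x + r) - (scalar c * d + q) \<in> N" by (simp add: algebra_simps)
      moreover have "scalar c * d + q \<in> A.span D"
        using d(1) q(1) A.span_add A.span_scale A.span_base by blast
      ultimately show ?case by blast
    qed
    moreover obtain r where r: "r \<in> A.span C" "p - r \<in> N" using span by blast
    ultimately obtain q where q: "q \<in> A.span D" "r - q \<in> N" by blast
    have "p - q \<in> N" using relation_ideal_closed(2)[OF r(2) q(2)] by simp
    then have "v = coset N q" using p coset_eq_iff[OF left_ideal_relation_ideal] by blast
    moreover obtain u where u: "q = (\<Sum>b\<in>D. scalar (u b) * b)"
      using q(1) A.span_finite[OF fD] by auto
    ultimately have "v = (\<Oplus>\<^bsub>?M\<^esub>b\<in>D. u b \<odot>\<^bsub>?M\<^esub> coset N b)" by (simp add: coset_finsum)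
    \<comment> \<open>Coefficients have to be functions of the coset, so each coset is sent back to
      its representative in \<open>D\<close>.\<close>
    also have "\<dots> = (\<Oplus>\<^bsub>?M\<^esub>b\<in>D. u (inv_into D (coset N) (coset N b)) \<odot>\<^bsub>?M\<^esub> coset N b)"
      by (intro M.finsum_cong') (auto simp: D(2) presented_module_simps)
    also have "\<dots> = (\<Oplus>\<^bsub>?M\<^esub>b\<in>coset N ` D. u (inv_into D (coset N) b) \<odot>\<^bsub>?M\<^esub> b)"
      by (rule M.finsum_reindex[symmetric, OF _ D(2)]) (auto simp: presented_module_simps)
    finally show ?thesis by (rule exI[of _ "\<lambda>b. u (inv_into D (coset N) b)"])
  qed
  then show ?thesis
    unfolding finite_dimensional_module_def
    by (intro exI[of _ "coset N ` D"]) (auto simp: fD presented_module_simps)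
qed

text \<open>The quotient by \<open>N\<close> becomes a \<open>lie_rep\<close>, to which
  \<open>finite_dimensional_cyclic_submodule\<close> applies. The module hypotheses concern only the
  cyclic vector; they spread to the whole module by \<open>rep_nilpotent_act\<close> for
  \<open>S\<close> and by stability under brackets for \<open>K\<close>.\<close>

theorem finite_dimensional_presented_module:
  assumes L: "lie_algebra scale bracket"
    and generates: "\<And>M. module.subspace scale M \<Longrightarrow> S \<subseteq> M \<Longrightarrow>
      (\<And>x y. x \<in> M \<Longrightarrow> y \<in> M \<Longrightarrow> bracket x y \<in> M) \<Longrightarrow> M = UNIV"
    and S: "\<And>s. s \<in> S \<Longrightarrow> locally_nilpotent (bracket s)" "\<And>s. s \<in> S \<Longrightarrow> \<exists>k. generator s ^ k \<in> N"
    and K: "\<And>x y. x \<in> K \<Longrightarrow> bracket x y \<in> K" "\<And>x. x \<in> K \<Longrightarrow> generator x \<in> N"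
    and fin: "finite B" and B: "\<And>x. \<exists>z\<in>module.span scale B. x - z \<in> K"
  shows "finite_dimensional_module (presented_module scale bracket R)"
proof -
  interpret L: lie_algebra scale bracket by (rule L)
  obtain \<pi> where lin: "Vector_Spaces.linear scaleA scaleA \<pi>"
    and ker: "\<And>p. p \<in> N \<Longrightarrow> \<pi> p = 0" and \<pi>: "\<And>p. p - \<pi> p \<in> N"
    using A.exists_projection_along[OF subspace_relation_ideal] by blast
  interpret \<pi>: Vector_Spaces.linear scaleA scaleA \<pi> by (rule lin)
  have ker_eq: "\<pi> p = \<pi> q" if "p - q \<in> N" for p q
    using ker[OF that] by (simp add: \<pi>.diff)
  have \<pi>_act: "\<pi> (a * \<pi> p) = \<pi> (a * p)" for a p
    using relation_ideal_closed(3)[OF \<pi>, of a p] ker_eq[of "a * p" "a * \<pi> p"]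
    by (simp add: algebra_simps)
  \<comment> \<open>This is the module \<open>A / N\<close>, realised on a complement of \<open>N\<close> in \<open>A\<close>; on \<open>N\<close> itself it is 0.\<close>
  define \<rho> where "\<rho> x p = \<pi> (generator x * p)" for x p
  interpret lie_rep scale bracket scaleA \<rho>
  proof unfold_locales
    fix x y :: 'l and c and p q :: "'l free_algebra"
    show "\<rho> (x + y) p = \<rho> x p + \<rho> y p"
      using ker_eq[of "generator (x + y) * p" "generator x * p + generator y * p"]
        generator_relations(1)[of x y p]
      by (simp add: \<rho>_def \<pi>.add algebra_simps)
    show "\<rho> (scale c x) p = scalar c * \<rho> x p"
      using ker_eq[of "generator (scale c x) * p" "scalar c * (generator x * p)"]
        generator_relations(2)[of c x p]
      by (simp add: \<rho>_def \<pi>.scale algebra_simps)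
    show "\<rho> x (p + q) = \<rho> x p + \<rho> x q"
      by (simp add: \<rho>_def \<pi>.add algebra_simps)
    have "generator x * (scalar c * p) = scalar c * (generator x * p)"
      using scalar_commute[of c "generator x"] by (simp flip: mult.assoc)
    then show "\<rho> x (scalar c * p) = scalar c * \<rho> x p"
      by (simp add: \<rho>_def \<pi>.scale)
    show "\<rho> (bracket x y) p = \<rho> x (\<rho> y p) - \<rho> y (\<rho> x p)"
      using ker_eq[of "generator x * (generator y * p) - generator y * (generator x * p)"
          "generator (bracket x y) * p"]
        generator_relations(3)[of x y p]
      by (simp add: \<rho>_def \<pi>_act \<pi>.diff algebra_simps)
  qed
  \<comment> \<open>Induction over the cyclic module: the product of \<open>generator x\<close> and
    \<open>p\<close> differs from \<open>\<rho> x p\<close> by an element of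
    \<open>N\<close>.\<close>
  have generated: "p \<in> W"
    if W: "A.subspace W" "N \<subseteq> W" "1 \<in> W" "\<And>x p. p \<in> W \<Longrightarrow> \<rho> x p \<in> W" for W p
  proof (rule free_algebra_generated)
    fix x p assume "p \<in> W"
    then have "\<pi> (generator x * p) + (generator x * p - \<pi> (generator x * p)) \<in> W"
      using W \<pi> unfolding \<rho>_def by (blast intro: A.subspace_add)
    then show "generator x * p \<in> W" by simp
  qed (use W A.subspace_add A.subspace_scale in blast)+
  have \<rho>_N: "\<rho> x p = 0" if "p \<in> N" for x p
    using that by (simp add: \<rho>_def ker relation_ideal_closed)
  have "S \<subseteq> good"
  proof
    fix s assume s: "s \<in> S"
    have nil: "\<exists>k. (\<rho> s ^^ k) p = 0" for p
    proof -
      have "p \<in> {p. \<exists>k. (\<rho> s ^^ k) p = 0}"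
      proof (rule generated[OF subspace_rep_nilpotent])
        \<comment> \<open>The exponent is a successor because the zeroth power gives 1 and not
          \<open>\<pi> 1\<close>.\<close>
        have "(\<rho> s ^^ Suc k) 1 = \<pi> (generator s ^ Suc k)" for k
          by (induction k) (simp_all add: \<rho>_def \<pi>_act)
        moreover obtain k where "generator s ^ k \<in> N" using S(2)[OF s] by blast
        ultimately have "(\<rho> s ^^ Suc k) 1 = 0"
          by (simp add: ker relation_ideal_closed(3))
        then show "1 \<in> {p. \<exists>k. (\<rho> s ^^ k) p = 0}" by blast
        show "N \<subseteq> {p. \<exists>k. (\<rho> s ^^ k) p = 0}"
          using \<rho>_N by (auto intro!: exI[of _ 1])
        show "\<rho> x p \<in> {p. \<exists>k. (\<rho> s ^^ k) p = 0}" if p: "p \<in> {p. \<exists>k. (\<rho> s ^^ k) p = 0}" for x p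
        proof -
          obtain b where b: "(\<rho> s ^^ b) p = 0" using p by blast
          obtain a where a: "(bracket s ^^ a) x = 0"
            using S(1)[OF s] unfolding locally_nilpotent_def by blast
          show ?thesis using rep_nilpotent_act[OF a b] by blast
        qed
      qed
      then show ?thesis by blast
    qed
    then show "s \<in> good" using S(1)[OF s] by (simp add: good_def locally_nilpotent_def)
  qed
  have K0: "\<rho> x p = 0" if "x \<in> K" for x p
  proof -
    \<comment> \<open>The vectors killed by \<open>K\<close> form a submodule: x y p = y x p +
      [x, y] p, and [x, y] is again in \<open>K\<close>.\<close>
    have "p \<in> {p. \<forall>x\<in>K. \<rho> x p = 0}"
    proof (rule generated)
      show "A.subspace {p. \<forall>x\<in>K. \<rho> x p = 0}"
        by (rule A.subspaceI) (auto simp: rep_add_right rep_scale_right)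
      show "\<rho> y p \<in> {p. \<forall>x\<in>K. \<rho> x p = 0}" if p: "p \<in> {p. \<forall>x\<in>K. \<rho> x p = 0}" for y p
      proof clarify
        fix x assume x: "x \<in> K"
        then have "\<rho> (bracket x y) p = 0" "\<rho> x p = 0" using p K(1) by auto
        then show "\<rho> x (\<rho> y p) = 0" by (simp add: rep_bracket)
      qed
    qed (use \<rho>_N K(2) in \<open>auto simp: \<rho>_def ker\<close>)
    with that show ?thesis by blast
  qed
  have "\<exists>z\<in>L.span B. \<forall>p. \<rho> x p = \<rho> z p" for x
    using B[of x] K0 by (metis rep_diff(1) right_minus_eq)
  from finite_dimensional_cyclic_submodule[OF \<open>S \<subseteq> good\<close> generates fin this, of "\<pi> 1"]
  obtain C where C: "finite C" "\<pi> 1 \<in> A.span C" "\<And>x p. p \<in> A.span C \<Longrightarrow> \<rho> x p \<in> A.span C"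
    by blast
  have "p \<in> {p. \<pi> p \<in> A.span C}" for p
  proof (rule generated)
    show "A.subspace {p. \<pi> p \<in> A.span C}"
      by (rule A.subspaceI) (auto simp: \<pi>.zero \<pi>.add \<pi>.scale intro: A.span_zero A.span_add A.span_scale)
    show "\<rho> x p \<in> {p. \<pi> p \<in> A.span C}" if "p \<in> {p. \<pi> p \<in> A.span C}" for x p
    proof -
      have "\<pi> (\<rho> x p) = \<rho> x (\<pi> p)"
        using \<pi>_act[of 1] by (simp add: \<rho>_def \<pi>_act)
      with that C(3) show ?thesis by simp
    qed
  qed (use C(2) ker A.span_zero in auto)
  with \<pi> C(1) finite_dimensional_module_if_span show ?thesis by blast
qed

end

section \<open>Generation by root vectors\<close>

context lie_algebra
begin

lemma bracket_derivation:
  "bracket h (bracket x y) = bracket (bracket h x) y + bracket x (bracket h y)"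
  using lie_rep.rep_bracket[OF lie_rep_adjoint, of h x y] by (simp add: algebra_simps)

lemma bracket_diff: "bracket (x - y) z = bracket x z - bracket y z" "bracket x (y - z) = bracket x y - bracket x z"
  using lie_rep.rep_diff[OF lie_rep_adjoint] by auto

text \<open>Applying ad h - d removes the component for d and multiplies every other component by
  the nonzero number c - d. The components are indexed by their eigenvalues and may be zero.\<close>

lemma eigencomponents_in_invariant_subspace:
  assumes W: "subspace W" "\<And>w. w \<in> W \<Longrightarrow> bracket h w \<in> W"
    and I: "finite I" and eig: "\<And>c. c \<in> I \<Longrightarrow> bracket h (v c) = scale c (v c)"
    and sum: "(\<Sum>c\<in>I. v c) \<in> W"
  shows "\<forall>c\<in>I. v c \<in> W"
  using I eig sum
proof (induction I arbitrary: v rule: finite_induct)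
  case (insert d I)
  have "bracket h (\<Sum>c\<in>insert d I. v c) - scale d (\<Sum>c\<in>insert d I. v c) = (\<Sum>c\<in>I. scale (c - d) (v c))"
  proof -
    have "bracket h (\<Sum>c\<in>insert d I. v c) = (\<Sum>c\<in>insert d I. scale c (v c))"
      unfolding bracket_sum_right by (intro sum.cong refl insert.prems(1))
    then show ?thesis
      by (simp only: scale_sum_right sum_subtractf[symmetric] scale_left_diff_distrib[symmetric])
        (simp add: insert.hyps)
  qed
  moreover have "bracket h (\<Sum>c\<in>insert d I. v c) - scale d (\<Sum>c\<in>insert d I. v c) \<in> W"
    using insert.prems(2) W by (intro subspace_diff subspace_scale) auto
  ultimately have "\<forall>c\<in>I. scale (c - d) (v c) \<in> W"
    using insert.prems(1) by (intro insert.IH) (auto simp: bracket_scale_right mult.commute)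
  then have I: "v c \<in> W" if "c \<in> I" for c
  proof -
    have "c \<noteq> d" using that insert.hyps by blast
    then have "v c = scale (inverse (c - d)) (scale (c - d) (v c))" by simp
    then show ?thesis using W(1) \<open>\<forall>c\<in>I. scale (c - d) (v c) \<in> W\<close> that subspace_scale by metis
  qed
  moreover have "v d = (\<Sum>c\<in>insert d I. v c) - (\<Sum>c\<in>I. v c)" using insert.hyps by simp
  then have "v d \<in> W" using W(1) insert.prems(2) I by (metis subspace_diff subspace_sum)
  ultimately show ?case by blast
qed simp

text \<open>Otherwise the \<open>u k\<close> would be infinitely many eigenvectors for distinct
  eigenvalues, hence independent.\<close>

lemma finitely_many_eigenvalues:
  assumes fd: finite_dimensional
    and eig: "\<And>k :: nat. bracket h (u k) = scale (c k) (u k)" and c: "inj c"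
  shows "\<exists>k. u k = 0"
proof (rule ccontr)
  assume "\<nexists>k. u k = 0"
  then have u: "u k \<noteq> 0" for k by blast
  have inj: "inj u"
  proof (rule injI)
    fix k l assume "u k = u l"
    then have "scale (c k) (u k) = scale (c l) (u k)" using eig[of k] eig[of l] by metis
    then have "c k = c l" using u scale_right_imp_eq by blast
    then show "k = l" using c by (simp add: inj_eq)
  qed
  have "independent (range u)"
    unfolding dependent_explicit
  proof clarify
    fix S r x assume S: "finite S" "S \<subseteq> range u" "(\<Sum>v\<in>S. scale (r v) v) = 0" and x: "x \<in> S" "r x \<noteq> 0"
    define J where "J = u -` S"
    have J: "S = u ` J" "finite J" using S(1,2) inj by (auto simp: J_def finite_vimageI)
    \<comment> \<open>The relation is reindexed by eigenvalues, so that
      \<open>eigencomponents_in_invariant_subspace\<close> with the zero subspace makes every term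
      vanish.\<close>
    have "(\<Sum>d\<in>c ` J. scale (r (u (inv_into UNIV c d))) (u (inv_into UNIV c d))) = 0"
      using S(3) c inj by (simp add: J sum.reindex inj_on_subset[OF _ subset_UNIV])
    then have "\<forall>d\<in>c ` J. scale (r (u (inv_into UNIV c d))) (u (inv_into UNIV c d)) \<in> {0}"
      using J(2) c
      by (intro eigencomponents_in_invariant_subspace[where h = h])
        (auto simp: subspace_single_0 bracket_scale_right eig mult.commute)
    moreover obtain k where "k \<in> J" "x = u k" using x J by blast
    ultimately show False using x(2) u c by auto
  qed
  moreover obtain B where "finite B" "span B = UNIV" using fd unfolding finite_dimensional_def by blast
  ultimately have "finite (range u)" using independent_span_bound by blast
  then show False using inj by (simp add: finite_image_iff)
qed

text \<open>For \<open>\<mu>\<close> not a nonnegative integer, \<open>fe\<close> is injective on the weight space of weight \<open>\<mu>\<close>: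
  otherwise \<open>e f\<^sup>k\<^sup>+\<^sup>1 z = (k + 1) (\<mu> - k) f\<^sup>k z\<close> and no \<open>f\<^sup>k z\<close> would vanish.\<close>

lemma sl2_weight_injective:
  assumes h: "bracket e f = h" "bracket h f = scale (- 2) f"
    and z: "bracket h z = scale \<mu> z" "bracket f (bracket e z) = 0" "(bracket f ^^ K) z = 0"
    and \<mu>: "\<And>k :: nat. \<mu> \<noteq> of_nat k"
  shows "z = 0"
proof -
  have ef: "bracket e (bracket f u) = bracket f (bracket e u) + bracket h u" for u
    using bracket_derivation[of e f u] h(1) by simp
  have hf: "bracket h ((bracket f ^^ k) z) = scale (\<mu> - 2 * of_nat k) ((bracket f ^^ k) z)" for k
  proof (induction k)
    case (Suc k)
    have "\<mu> - 2 * of_nat (Suc k) = - 2 + (\<mu> - 2 * of_nat k)" by simp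
    then show ?case
      unfolding funpow.simps(2) comp_apply bracket_derivation[of h f] h(2) Suc
      by (simp only: bracket_scale_left bracket_scale_right scale_left_distrib)
  qed (simp add: z)
  have *: "bracket e ((bracket f ^^ Suc k) z) = scale (of_nat (Suc k) * (\<mu> - of_nat k)) ((bracket f ^^ k) z)" for k
  proof (induction k)
    case (Suc k)
    have "of_nat (Suc (Suc k)) * (\<mu> - of_nat (Suc k))
        = of_nat (Suc k) * (\<mu> - of_nat k) + (\<mu> - 2 * of_nat (Suc k))"
      by (simp add: algebra_simps)
    moreover have fp: "bracket f ((bracket f ^^ k) z) = (bracket f ^^ Suc k) z" for k by simp
    have "bracket e ((bracket f ^^ Suc (Suc k)) z)
        = scale (of_nat (Suc k) * (\<mu> - of_nat k)) ((bracket f ^^ Suc k) z)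
          + scale (\<mu> - 2 * of_nat (Suc k)) ((bracket f ^^ Suc k) z)"
      using ef[of "(bracket f ^^ Suc k) z"] unfolding Suc hf bracket_scale_right fp .
    ultimately show ?case by (simp only: scale_left_distrib)
  qed (simp add: ef z)
  \<comment> \<open>The scalar in the previous formula is nonzero by the assumption on
    \<open>\<mu>\<close>, so vanishing descends from f^K z to z.\<close>
  have "(bracket f ^^ k) z = 0" if "(bracket f ^^ Suc k) z = 0" for k
    using *[of k] that \<mu>[of k] by (auto simp del: of_nat_Suc)
  then show ?thesis using z(3) by (induction K) auto
qed

section \<open>Root spaces and the root decomposition\<close>

lemma root_space_bracket:
  assumes "x \<in> root_space H a" "y \<in> root_space H b"
  shows "bracket x y \<in> root_space H (\<lambda>h. a h + b h)"
  using assms unfolding root_space_def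
  by (auto simp: bracket_derivation bracket_scale_left bracket_scale_right scale_left_distrib)

lemma subspace_root_space: "subspace (root_space H a)"
  unfolding root_space_def
  by (rule subspaceI) (auto simp: bracket_add_right bracket_scale_right scale_right_distrib mult.commute)

lemma root_space_cong: "(\<And>h. h \<in> H \<Longrightarrow> a h = b h) \<Longrightarrow> root_space H a = root_space H b"
  unfolding root_space_def by auto

lemma cartan_subalgebraD:
  assumes "cartan_subalgebra H"
  shows "subspace H" "\<And>h k. h \<in> H \<Longrightarrow> k \<in> H \<Longrightarrow> bracket h k = 0"
    and "\<And>x. (\<And>h. h \<in> H \<Longrightarrow> bracket h x = 0) \<Longrightarrow> x \<in> H"
    and "\<And>h. h \<in> H \<Longrightarrow> span {x. \<exists>c. bracket h x = scale c x} = UNIV"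
  using assms unfolding cartan_subalgebra_def by blast+

text \<open>A joint eigenvector of \<open>hs\<close> is split into eigencomponents for the new
  \<open>h\<close>. As \<open>h\<close> commutes with each h' in \<open>hs\<close>, the eigenspaces
  of h' are ad h-invariant and contain these components.\<close>

lemma simultaneous_eigenvectors_span:
  assumes H: "cartan_subalgebra H" and "finite hs" "hs \<subseteq> H"
  shows "span {x. \<forall>h\<in>hs. \<exists>c. bracket h x = scale c x} = UNIV"
  using assms(2,3)
proof (induction hs rule: finite_induct)
  case (insert h hs)
  let ?E = "\<lambda>hs. {x. \<forall>h\<in>hs. \<exists>c. bracket h x = scale c x}"
  have "x \<in> span (?E (insert h hs))" if x: "x \<in> ?E hs" for x
  proof -
    have "x \<in> span {x. \<exists>c. bracket h x = scale c x}"
      using cartan_subalgebraD(4)[OF H] insert.prems by auto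
    then obtain t r where t: "finite t" "t \<subseteq> {x. \<exists>c. bracket h x = scale c x}"
        "x = (\<Sum>a\<in>t. scale (r a) a)"
      unfolding span_explicit by blast
    then have "\<forall>a\<in>t. \<exists>c. bracket h a = scale c a" by blast
    then obtain c where c: "\<And>a. a \<in> t \<Longrightarrow> bracket h a = scale (c a) a" by metis
    define v where "v d = (\<Sum>a\<in>{a\<in>t. c a = d}. scale (r a) a)" for d
    have xv: "x = (\<Sum>d\<in>c ` t. v d)"
      unfolding t(3) v_def by (rule sum.image_gen[OF t(1)])
    have eig: "bracket h (v d) = scale d (v d)" for d
      by (auto simp: v_def bracket_sum_right scale_sum_right c bracket_scale_right mult.commute
          intro!: sum.cong)
    have "v d \<in> ?E (insert h hs)" if d: "d \<in> c ` t" for d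
    proof -
      have "\<exists>\<mu>. bracket h' (v d) = scale \<mu> (v d)" if h': "h' \<in> hs" for h'
      proof -
        obtain \<mu> where \<mu>: "bracket h' x = scale \<mu> x" using x h' by blast
        let ?W = "{w. bracket h' w = scale \<mu> w}"
        have "\<forall>d\<in>c ` t. v d \<in> ?W"
        proof (rule eigencomponents_in_invariant_subspace[where h = h])
          show "subspace ?W"
            by (rule subspaceI) (auto simp: bracket_add_right bracket_scale_right scale_right_distrib mult.commute)
          show "bracket h w \<in> ?W" if "w \<in> ?W" for w
          proof -
            have "bracket h' h = 0"
              using cartan_subalgebraD(2)[OF H] h' insert.prems by auto
            then show ?thesis using that bracket_derivation[of h' h w] by (simp add: bracket_scale_right)
          qed
        qed (use t(1) eig \<mu> xv in auto)
        then show ?thesis using d by blast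
      qed
      then show ?thesis using eig by blast
    qed
    then show ?thesis unfolding xv by (intro span_sum span_base)
  qed
  then have "span (?E hs) \<subseteq> span (?E (insert h hs))"
    by (intro span_minimal subspace_span) blast
  with insert show ?case by auto
qed simp

text \<open>The eigenvalues form a functional on \<open>H\<close>, linear because \<open>x\<close>
  is nonzero. If it vanishes on \<open>H\<close>, then \<open>x\<close> centralizes \<open>H\<close>
  and so lies in it.\<close>

lemma eigenvector_in_root_space:
  assumes H: "cartan_subalgebra H"
    and x: "x \<noteq> 0" "\<And>h. h \<in> H \<Longrightarrow> \<exists>c. bracket h x = scale c x"
  shows "x \<in> H \<or> (\<exists>\<beta>\<in>roots H. x \<in> root_space H \<beta>)"
proof -
  obtain a where a: "\<And>h. h \<in> H \<Longrightarrow> bracket h x = scale (a h) x" using x(2) by metis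
  define \<beta> where "\<beta> h = (if h \<in> H then a h else 0)" for h
  have \<beta>: "bracket h x = scale (\<beta> h) x" if "h \<in> H" for h using a that by (simp add: \<beta>_def)
  have unique: "c = d" if "scale c x = scale d x" for c d using that x(1) by simp
  note sub = cartan_subalgebraD(1)[OF H]
  have "\<beta> \<in> dual_space H"
    unfolding dual_space_def
  proof (intro CollectI conjI ballI allI impI)
    fix h k c assume hk: "h \<in> H" "k \<in> H"
    have "scale (\<beta> (h + k)) x = scale (\<beta> h + \<beta> k) x"
      using hk sub by (simp add: \<beta>[symmetric] subspace_add scale_left_distrib bracket_add_left)
    then show "\<beta> (h + k) = \<beta> h + \<beta> k" by (rule unique)
  next
    fix c h assume h: "h \<in> H"
    have "scale (\<beta> (scale c h)) x = scale (c * \<beta> h) x"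
      using h sub by (simp add: \<beta>[symmetric] subspace_scale bracket_scale_left flip: scale_scale)
    then show "\<beta> (scale c h) = c * \<beta> h" by (rule unique)
  qed (simp add: \<beta>_def)
  moreover have "x \<in> root_space H \<beta>" using \<beta> by (simp add: root_space_def)
  moreover from this x(1) have "root_space H \<beta> \<noteq> {0}" by blast
  moreover have "x \<in> H" if "\<forall>h\<in>H. \<beta> h = 0"
    using that \<beta> by (intro cartan_subalgebraD(3)[OF H]) auto
  ultimately show ?thesis unfolding roots_def by blast
qed

text \<open>A joint eigenvector of a finite basis of \<open>H\<close> is an eigenvector of all of
  \<open>H\<close>, so simultaneous diagonalization of finitely many operators suffices.\<close>

lemma root_decomposition:
  assumes fd: finite_dimensional and H: "cartan_subalgebra H"
  shows "span (H \<union> (\<Union>\<beta>\<in>roots H. root_space H \<beta>)) = UNIV"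
proof -
  obtain hs where hs: "hs \<subseteq> H" "independent hs" "H \<subseteq> span hs"
    using maximal_independent_subset by blast
  obtain B where "finite B" "span B = UNIV" using fd unfolding finite_dimensional_def by blast
  then have "finite hs" using independent_span_bound hs(2) by blast
  have "x \<in> span (H \<union> (\<Union>\<beta>\<in>roots H. root_space H \<beta>))"
    if x: "\<forall>h\<in>hs. \<exists>c. bracket h x = scale c x" for x
  proof (cases "x = 0")
    case False
    have "\<exists>c. bracket h x = scale c x" if "h \<in> H" for h
    proof -
      from that hs(3) have "h \<in> span hs" by blast
      then show ?thesis
      proof (induction h rule: span_induct_alt)
        case base
        show ?case by (auto intro: exI[of _ 0])
      next
        case (step r y k)
        then obtain c d where "bracket y x = scale c x" "bracket k x = scale d x" using x by blast
        then have "bracket (scale r y + k) x = scale (r * c + d) x"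
          by (simp add: bracket_add_left bracket_scale_left scale_left_distrib)
        then show ?case by blast
      qed
    qed
    from eigenvector_in_root_space[OF H False this] show ?thesis
      by (auto intro: span_base)
  qed (simp add: span_zero)
  then have "span {x. \<forall>h\<in>hs. \<exists>c. bracket h x = scale c x}
      \<subseteq> span (H \<union> (\<Union>\<beta>\<in>roots H. root_space H \<beta>))"
    by (intro span_minimal subspace_span) blast
  with simultaneous_eigenvectors_span[OF H \<open>finite hs\<close> hs(1)] show ?thesis by blast
qed

text \<open>Each application of ad x shifts the eigenvalue of ad h by the nonzero number a(h), and
  only finitely many eigenvalues occur. Eigenvectors of ad h span.\<close>

lemma root_vector_locally_nilpotent:
  assumes fd: finite_dimensional and H: "cartan_subalgebra H"
    and x: "x \<in> root_space H a" and h: "h \<in> H" "a h \<noteq> 0"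
  shows "locally_nilpotent (bracket x)"
proof -
  interpret adj: lie_rep scale bracket scale bracket by (rule lie_rep_adjoint)
  have nil: "\<exists>k. (bracket x ^^ k) y = 0" if y: "bracket h y = scale b y" for y b
  proof (rule finitely_many_eigenvalues[OF fd])
    show "bracket h ((bracket x ^^ k) y) = scale (b + of_nat k * a h) ((bracket x ^^ k) y)" for k
    proof (induction k)
      case (Suc k)
      have hx: "bracket h x = scale (a h) x" using x h(1) by (simp add: root_space_def)
      have "b + of_nat (Suc k) * a h = a h + (b + of_nat k * a h)" by (simp add: algebra_simps)
      then show ?case
        unfolding funpow.simps(2) comp_apply bracket_derivation[of h x] hx Suc
        by (simp only: bracket_scale_left bracket_scale_right bracket_add_right scale_left_distrib)
    qed (simp add: y)
    show "inj (\<lambda>k. b + of_nat k * a h)" using h(2) by (auto intro!: injI)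
  qed
  have "span {y. \<exists>b. bracket h y = scale b y} \<subseteq> {y. \<exists>k. (bracket x ^^ k) y = 0}"
    using nil by (intro span_minimal adj.subspace_rep_nilpotent) blast
  then show ?thesis
    using cartan_subalgebraD(4)[OF H h(1)] unfolding locally_nilpotent_def by blast
qed

end

section \<open>Classical Cartan matrices\<close>

text \<open>The increments are nondecreasing and the last one is at most 0, so the sequence
  decreases from 0 while staying nonnegative.\<close>

lemma convex_sequence_eq_0:
  fixes a :: "nat \<Rightarrow> int"
  assumes conv: "\<And>j. 1 \<le> j \<Longrightarrow> j \<le> q \<Longrightarrow> 2 * a j \<le> a (j - 1) + a (j + 1)"
    and a: "a 0 = 0" "\<And>j. a j \<ge> 0" "a (q + 1) \<le> a q" and j: "j \<le> q + 1"
  shows "a j = 0"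
proof -
  have le: "a (j + 1) \<le> a j" if "j \<le> q" for j
    using that
  proof (induction rule: inc_induct)
    case (step j)
    then show ?case using conv[of "Suc j"] by simp
  qed (use a in simp)
  have "a j \<le> 0" using j
  proof (induction j)
    case (Suc j)
    then show ?case using le[of j] by simp
  qed (simp add: a)
  with a(2)[of j] show ?thesis by simp
qed

text \<open>Extending the coefficients by 0 to the indices 0 and n + 1 makes the chain part a
  uniform second difference; the case distinction records how each type deviates from the chain near
  its end.\<close>

lemma cartan_column_sum:
  fixes k :: "nat \<Rightarrow> nat"
  assumes j: "j \<in> {1..n}" and rank: "valid_rank X n"
  defines "a \<equiv> \<lambda>i. if i \<in> {1..n} then int (k i) else 0"
  shows "(\<Sum>i = 1..n. int (k i) * cartan_matrix X n i j) = 2 * a j - a (j - 1) - a (j + 1) +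
    (case X of
       Type_A \<Rightarrow> 0
     | Type_B \<Rightarrow> if j = n then - a (n - 1) else 0
     | Type_C \<Rightarrow> if j + 1 = n then - a n else 0
     | Type_D \<Rightarrow> if j = n then a (n - 1) - a (n - 2) else if j + 1 = n then a n
                else if j + 2 = n then - a n else 0)"
proof -
  have delta: "(\<Sum>i = 1..n. int (k i) * (if i = l \<and> P then d else 0)) = (if P then d * a l else 0)" for l d P
  proof -
    have "(\<Sum>i = 1..n. int (k i) * (if i = l \<and> P then d else 0)) = (\<Sum>i = 1..n. if i = l then (if P then d * int (k i) else 0) else 0)"
      by (intro sum.cong refl) auto
    then show ?thesis by (simp add: a_def)
  qed
  \<comment> \<open>\<open>K\<close> is a single matrix entry, with value \<open>d\<close> in row
    \<open>l\<close> under condition \<open>P\<close>. Each column is written as a sum of such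
    entries, and each sum over \<open>i\<close> collapses to one value of \<open>a\<close>.\<close>
  define K where "K i l P d = int (k i) * (if i = l \<and> P then d else 0)" for i l :: nat and P and d :: int
  have K: "(\<Sum>i = 1..n. K i l P d) = (if P then d * a l else 0)" for l P d
    unfolding K_def by (rule delta)
  have chain: "int (k i) * chain_matrix i j = K i j True 2 + K i (j - 1) True (- 1) + K i (j + 1) True (- 1)"
    if "i \<in> {1..n}" for i
    using that j by (auto simp: chain_matrix_def K_def)
  show ?thesis
  proof (cases X)
    case Type_A
    have "(\<Sum>i = 1..n. int (k i) * cartan_matrix X n i j) =
        (\<Sum>i = 1..n. K i j True 2 + K i (j - 1) True (- 1) + K i (j + 1) True (- 1))"
      using chain by (intro sum.cong) (simp_all add: Type_A)
    then show ?thesis by (simp add: sum.distrib K[simplified] Type_A)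
  next
    case Type_B
    have "int (k i) * cartan_matrix X n i j = int (k i) * chain_matrix i j + K i (n - 1) (j = n) (- 1)"
      if "i \<in> {1..n}" for i
      using that j by (auto simp: Type_B chain_matrix_def K_def)
    then have "(\<Sum>i = 1..n. int (k i) * cartan_matrix X n i j) = (\<Sum>i = 1..n. K i j True 2 +
        K i (j - 1) True (- 1) + K i (j + 1) True (- 1) + K i (n - 1) (j = n) (- 1))"
      using chain by (intro sum.cong) simp_all
    then show ?thesis by (simp add: sum.distrib K[simplified] Type_B)
  next
    case Type_C
    have "int (k i) * cartan_matrix X n i j = int (k i) * chain_matrix i j + K i n (j + 1 = n) (- 1)"
      if "i \<in> {1..n}" for i
      using that j by (auto simp: Type_C chain_matrix_def K_def)
    then have "(\<Sum>i = 1..n. int (k i) * cartan_matrix X n i j) = (\<Sum>i = 1..n. K i j True 2 +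
        K i (j - 1) True (- 1) + K i (j + 1) True (- 1) + K i n (j + 1 = n) (- 1))"
      using chain by (intro sum.cong) simp_all
    then show ?thesis by (simp add: sum.distrib K[simplified] Type_C)
  next
    case Type_D
    have n: "n \<ge> 3" using rank Type_D by simp
    have "int (k i) * cartan_matrix X n i j = int (k i) * chain_matrix i j + K i (n - 1) (j = n) 1
        + K i (n - 2) (j = n) (- 1) + K i n (j + 1 = n) 1 + K i n (j + 2 = n) (- 1)"
      if i: "i \<in> {1..n}" for i
    proof -
      consider "j = n" | "j + 1 = n" | "j + 2 = n" | "j \<noteq> n" "j + 1 \<noteq> n" "j + 2 \<noteq> n" by blast
      then show ?thesis
        by cases (use i n in \<open>auto simp: Type_D chain_matrix_def K_def\<close>)
    qed
    then have "(\<Sum>i = 1..n. int (k i) * cartan_matrix X n i j) = (\<Sum>i = 1..n. K i j True 2 +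
        K i (j - 1) True (- 1) + K i (j + 1) True (- 1) + K i (n - 1) (j = n) 1
        + K i (n - 2) (j = n) (- 1) + K i n (j + 1 = n) 1 + K i n (j + 2 = n) (- 1))"
      using chain by (intro sum.cong) simp_all
    then show ?thesis using n by (auto simp: sum.distrib K[simplified] Type_D)
  qed
qed

text \<open>If all column sums were nonpositive, the coefficients would form a convex sequence along
  the chain, and the columns near the end would bound its last increment by 0; then all coefficients
  vanish. This stands in for positive definiteness.\<close>

lemma exists_positive_cartan_column_sum:
  fixes k :: "nat \<Rightarrow> nat"
  assumes rank: "valid_rank X n" and k: "\<exists>i\<in>{1..n}. k i \<noteq> 0"
  shows "\<exists>j\<in>{1..n}. (\<Sum>i = 1..n. int (k i) * cartan_matrix X n i j) > 0"
proof (rule ccontr)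
  assume *: "\<not> ?thesis"
  define a where "a i = (if i \<in> {1..n} then int (k i) else 0)" for i
  have col: "2 * a j - a (j - 1) - a (j + 1) +
    (case X of
       Type_A \<Rightarrow> 0
     | Type_B \<Rightarrow> if j = n then - a (n - 1) else 0
     | Type_C \<Rightarrow> if j + 1 = n then - a n else 0
     | Type_D \<Rightarrow> if j = n then a (n - 1) - a (n - 2) else if j + 1 = n then a n
                else if j + 2 = n then - a n else 0) \<le> 0" if "j \<in> {1..n}" for j
  proof -
    have "(\<Sum>i = 1..n. int (k i) * cartan_matrix X n i j) \<le> 0" using * that not_less by blast
    then show ?thesis unfolding cartan_column_sum[OF that rank] a_def .
  qed
  have a: "a 0 = 0" "\<And>j. a j \<ge> 0" "a (n + 1) = 0" by (auto simp: a_def)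
  have "a j = 0" if "j \<in> {1..n}" for j
  proof (cases X)
    case Type_A
    show ?thesis
      by (rule convex_sequence_eq_0[of n]) (use a that col Type_A in \<open>fastforce+\<close>)
  next
    case Type_B
    show ?thesis
    proof (rule convex_sequence_eq_0[of "n - 1"])
      show "2 * a j \<le> a (j - 1) + a (j + 1)" if "1 \<le> j" "j \<le> n - 1" for j
      proof -
        have "j \<in> {1..n}" "j \<noteq> n" using that rank Type_B by auto
        then show ?thesis using col[of j] Type_B by simp
      qed
      show "a (n - 1 + 1) \<le> a (n - 1)" using col[of n] that Type_B a by simp
    qed (use a that in auto)
  next
    case Type_C
    have n: "n \<ge> 2" using rank Type_C by simp
    have cn: "2 * a n \<le> a (n - 1)" using col[of n] that Type_C a by simp
    have 0: "a j = 0" if "j \<le> n - 1" for j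
    proof (rule convex_sequence_eq_0[of "n - 2"])
      show "2 * a j \<le> a (j - 1) + a (j + 1)" if "1 \<le> j" "j \<le> n - 2" for j
      proof -
        have "j \<in> {1..n}" "j \<noteq> n" "j + 1 \<noteq> n" using that n by auto
        then show ?thesis using col[of j] Type_C by simp
      qed
      have n': "n - 1 - 1 = n - 2" "n - 1 + 1 = n" "n - 2 + 1 = n - 1" using n by auto
      have "n - 1 \<in> {1..n}" "n - 1 \<noteq> n" using n by auto
      \<comment> \<open>Column n - 1 gives 2 a(n-1) <= a(n-2) + 2 a(n), and 2 a(n) <= a(n-1) by
        column n.\<close>
      from col[OF this(1)] this(2) cn show "a (n - 2 + 1) \<le> a (n - 2)" unfolding n' Type_C by simp
    qed (use a that in auto)
    show ?thesis
    proof (cases "j = n")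
      case True
      then show ?thesis using cn 0[of "n - 1"] a(2)[of n] by simp
    qed (use 0[of j] that in auto)
  next
    case Type_D
    have n: "n \<ge> 3" using rank Type_D by simp
    have n': "n - 1 - 1 = n - 2" "n - 1 + 1 = n" "n - 2 + 1 = n - 1" "n - 2 - 1 = n - 3" "n - 3 + 1 = n - 2"
      using n by auto
    have cn: "2 * a n \<le> a (n - 2)" using col[of n] that Type_D a by simp
    have cn1: "2 * a (n - 1) \<le> a (n - 2)"
    proof -
      have "n - 1 \<in> {1..n}" "n - 1 \<noteq> n" using n by auto
      from col[OF this(1)] this(2) show ?thesis unfolding n' Type_D by simp
    qed
    have 0: "a j = 0" if "j \<le> n - 2" for j
    proof (rule convex_sequence_eq_0[of "n - 3"])
      show "2 * a j \<le> a (j - 1) + a (j + 1)" if "1 \<le> j" "j \<le> n - 3" for j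
      proof -
        have "j \<in> {1..n}" "j \<noteq> n" "j + 1 \<noteq> n" "j + 2 \<noteq> n" using that n by auto
        then show ?thesis using col[of j] Type_D by simp
      qed
      have "n - 2 \<in> {1..n}" "n - 2 \<noteq> n" "n - 1 \<noteq> n" "n - 2 + 2 = n" using n by auto
      \<comment> \<open>At the branching node, 2 a(n-2) <= a(n-3) + a(n-1) + a(n), and each of the
        two ends contributes at most half of a(n-2).\<close>
      from col[OF this(1)] this(2-) cn cn1 show "a (n - 3 + 1) \<le> a (n - 3)"
        unfolding n' Type_D by simp
    qed (use a that in auto)
    have "j \<le> n - 2 \<or> j = n - 1 \<or> j = n" using that by auto
    then show ?thesis
      using 0 cn cn1 0[of "n - 2"] a(2)[of n] a(2)[of "n - 1"] by auto
  qed
  with k show False by (auto simp: a_def)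
qed

lemma cartan_matrix_nonpos: "i \<noteq> j \<Longrightarrow> cartan_matrix X n i j \<le> 0"
  by (cases X) (auto simp: chain_matrix_def)

section \<open>Generation of classical Lie algebras\<close>

text \<open>A vector of \<open>Z\<close> outside the image could be added to the image of a basis of
  \<open>Z\<close>, giving too many independent vectors in \<open>Z\<close>.\<close>

lemma (in vector_space) injective_imp_surjective_on_subspace:
  assumes C: "finite C" "span C = UNIV" and Z: "subspace Z"
    and T: "Vector_Spaces.linear scale scale T"
    and TZ: "\<And>z. z \<in> Z \<Longrightarrow> T z \<in> Z" and inj: "\<And>z. z \<in> Z \<Longrightarrow> T z = 0 \<Longrightarrow> z = 0"
  shows "T ` Z = Z"
proof
  show "T ` Z \<subseteq> Z" using TZ by blast
  interpret T: Vector_Spaces.linear scale scale T by (rule T)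
  obtain B where B: "B \<subseteq> Z" "independent B" "Z \<subseteq> span B"
    using maximal_independent_subset by blast
  have "finite B" using independent_span_bound[OF C(1) B(2)] C(2) by blast
  have span_B: "span B = Z" using span_minimal[OF B(1) Z] B(3) by (rule equalityI)
  have inj_T: "inj_on T Z"
  proof (rule inj_onI)
    fix x y assume xy: "x \<in> Z" "y \<in> Z" "T x = T y"
    have "x - y = 0" by (rule inj[OF subspace_diff[OF Z]]) (simp_all add: T.diff xy)
    then show "x = y" by simp
  qed
  have ind: "independent (T ` B)"
    by (rule T.independent_injective_image[OF B(2)]) (simp add: span_B inj_T)
  have card: "card (T ` B) = card B"
    by (rule card_image) (rule inj_on_subset[OF inj_T B(1)])
  have sub: "span (T ` B) \<subseteq> T ` Z"
    using T.span_image[of B] by (simp add: span_B)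
  show "Z \<subseteq> T ` Z"
  proof
    fix z assume z: "z \<in> Z"
    show "z \<in> T ` Z"
    proof (rule ccontr)
      assume "z \<notin> T ` Z"
      then have z': "z \<notin> span (T ` B)" using sub by blast
      then have "independent (insert z (T ` B))" using ind by (rule independent_insertI)
      moreover have "insert z (T ` B) \<subseteq> span B" using z B(1) TZ by (auto simp: span_B)
      ultimately have "card (insert z (T ` B)) \<le> card B"
        using independent_span_bound[OF \<open>finite B\<close>] by blast
      moreover have "z \<notin> T ` B" using z' span_superset by blast
      ultimately show False using \<open>finite B\<close> card by simp
    qed
  qed
qed

lemma (in lie_algebra) simple_roots_positive:
  assumes "simple_roots H n \<alpha>" and j: "j \<in> {1..n}"
  shows "\<alpha> j \<in> positive_roots H n \<alpha>"
proof -
  have "(\<Sum>i = 1..n. of_nat (if i = j then 1 else 0) * \<alpha> i h) = (\<Sum>i = 1..n. if i = j then \<alpha> i h else 0)" for h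
    by (intro sum.cong refl) auto
  then have "\<alpha> j h = (\<Sum>i = 1..n. of_nat (if i = j then 1 else 0) * \<alpha> i h)" for h
    using j by simp
  moreover have "\<alpha> j \<in> roots H" using assms unfolding simple_roots_def by blast
  ultimately show ?thesis
    unfolding positive_roots_def
    by (intro CollectI conjI exI[of _ "\<lambda>i. if i = j then 1 else 0"] ballI)
qed

section \<open>Negative root spaces and generation of the Lie algebra\<close>

locale classical_lie_algebra = lie_algebra scale bracket
  for scale :: "complex \<Rightarrow> 'g::ab_group_add \<Rightarrow> 'g" and bracket +
  fixes H :: "'g set" and X :: classical_type and n :: nat
    and \<alpha> :: "nat \<Rightarrow> 'g \<Rightarrow> complex" and hc f :: "nat \<Rightarrow> 'g"
  assumes fd: finite_dimensional and simple: simple and cartan: "cartan_subalgebra H"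
    and classical: "of_classical_type X H n \<alpha> hc"
    and f: "\<And>j. j \<in> {1..n} \<Longrightarrow> f j \<in> root_space H (\<lambda>h. - \<alpha> j h)"
    and f_nonzero: "\<And>j. j \<in> {1..n} \<Longrightarrow> f j \<noteq> 0"
begin

lemma rank_pos: "n \<ge> 1"
  using classical unfolding of_classical_type_def by (cases X) auto

lemma \<alpha>_root: "j \<in> {1..n} \<Longrightarrow> \<alpha> j \<in> roots H"
  using classical unfolding of_classical_type_def simple_roots_def by blast

lemma dual_spaceD:
  assumes "a \<in> dual_space H" "h \<in> H" "k \<in> H"
  shows "a (h + k) = a h + a k" "a (scale c h) = c * a h" "a 0 = 0"
  using assms cartan_subalgebraD(1)[OF cartan] unfolding dual_space_def
  by (auto dest: subspace_0) (metis mult_zero_left scale_zero_left subspace_0)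

lemma \<alpha>_coroot: "j \<in> {1..n} \<Longrightarrow> \<alpha> j (hc j) = 2"
  using classical unfolding of_classical_type_def is_coroot_def by blast

text \<open>The bracket has weight 0, and \<open>H\<close> is its own centralizer.\<close>

lemma root_space_opposite_bracket:
  assumes "x \<in> root_space H a" "y \<in> root_space H (\<lambda>h. - a h)"
  shows "bracket x y \<in> H"
  using root_space_bracket[OF assms]
  by (intro cartan_subalgebraD(3)[OF cartan]) (simp add: root_space_def)

lemma coroot_in_cartan:
  assumes "j \<in> {1..n}"
  shows "hc j \<in> H"
proof -
  have "hc j \<in> span {bracket x y | x y. x \<in> root_space H (\<alpha> j) \<and> y \<in> root_space H (\<lambda>k. - \<alpha> j k)}"
    using classical assms unfolding of_classical_type_def is_coroot_def by blast
  moreover have "\<dots> \<subseteq> H"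
    using root_space_opposite_bracket cartan_subalgebraD(1)[OF cartan] by (intro span_minimal) auto
  ultimately show ?thesis by blast
qed

lemma coroot_bracket_f: "j \<in> {1..n} \<Longrightarrow> bracket (hc j) (f j) = scale (- 2) (f j)"
  using f[of j] coroot_in_cartan[of j] \<alpha>_coroot[of j] by (simp add: root_space_def)

lemma f_locally_nilpotent: "j \<in> {1..n} \<Longrightarrow> locally_nilpotent (bracket (f j))"
  using root_vector_locally_nilpotent[OF fd cartan f[of j] coroot_in_cartan] \<alpha>_coroot by simp

text \<open>For e, y in the root spaces of \<alpha>_j and its negative with \<alpha>_j([e, y]) = 2,
  a suitable multiple of y is subtracted from any z so that [y, [e, w]] = 0 for the difference w.
  Its weight -2 is no natural number, so w = 0 by \<open>sl2_weight_injective\<close>.\<close>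

lemma negative_simple_root_space:
  assumes j: "j \<in> {1..n}"
  shows "root_space H (\<lambda>h. - \<alpha> j h) = range (\<lambda>c. scale c (f j))"
proof -
  have dual: "\<alpha> j \<in> dual_space H" using \<alpha>_root[OF j] by (simp add: roots_def)
  let ?P = "{bracket x y | x y. x \<in> root_space H (\<alpha> j) \<and> y \<in> root_space H (\<lambda>k. - \<alpha> j k)}"
  note subH = cartan_subalgebraD(1)[OF cartan]
  \<comment> \<open>The coroot lies in the span of these brackets and \<alpha>_j takes the value 2
    on it.\<close>
  have "\<exists>x y. x \<in> root_space H (\<alpha> j) \<and> y \<in> root_space H (\<lambda>k. - \<alpha> j k) \<and> \<alpha> j (bracket x y) \<noteq> 0"
  proof (rule ccontr)
    assume "\<not> ?thesis"
    then have "?P \<subseteq> {h \<in> H. \<alpha> j h = 0}" using root_space_opposite_bracket by blast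
    moreover have "subspace {h \<in> H. \<alpha> j h = 0}"
      using subH by (auto simp: subspace_def dual_spaceD[OF dual])
    ultimately have "span ?P \<subseteq> {h \<in> H. \<alpha> j h = 0}" by (rule span_minimal)
    then show False
      using classical j unfolding of_classical_type_def is_coroot_def by force
  qed
  then obtain x y where x: "x \<in> root_space H (\<alpha> j)" and y: "y \<in> root_space H (\<lambda>k. - \<alpha> j k)"
    and nz: "\<alpha> j (bracket x y) \<noteq> 0" by blast
  define e where "e = scale (2 / \<alpha> j (bracket x y)) x"
  have e: "e \<in> root_space H (\<alpha> j)" using x subspace_root_space subspace_scale unfolding e_def by blast
  define h where "h = bracket e y"
  have h: "h \<in> H" "\<alpha> j h = 2"
    using nz root_space_opposite_bracket[OF x y] root_space_opposite_bracket[OF e y] dual_spaceD(2)[OF dual]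
    by (simp_all add: h_def e_def bracket_scale_left)
  have act: "bracket k z = scale (- \<alpha> j k) z" if "k \<in> H" "z \<in> root_space H (\<lambda>k. - \<alpha> j k)" for k z
    using that by (simp add: root_space_def)
  have line: "\<exists>c. z = scale c y" if z: "z \<in> root_space H (\<lambda>k. - \<alpha> j k)" for z
  proof -
    \<comment> \<open>Since \<alpha>_j([e, y]) = 2, this choice makes \<alpha>_j([e, w])
      vanish.\<close>
    define c where "c = \<alpha> j (bracket e z) / 2"
    define w where "w = z - scale c y"
    have w: "w \<in> root_space H (\<lambda>k. - \<alpha> j k)"
      unfolding w_def using z y subspace_root_space subspace_diff subspace_scale by blast
    have ez: "bracket e z \<in> H" using root_space_opposite_bracket[OF e z] .
    have ew: "bracket e w = bracket e z + scale (- c) h"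
      by (simp add: w_def bracket_diff bracket_scale_right h_def)
    have ewH: "bracket e w \<in> H" using root_space_opposite_bracket[OF e w] .
    have "\<alpha> j (bracket e w) = \<alpha> j (bracket e z) + (- c) * 2"
      unfolding ew using ez h subH dual_spaceD[OF dual] subspace_scale by metis
    then have "\<alpha> j (bracket e w) = 0" by (simp add: c_def)
    then have "bracket y (bracket e w) = 0"
      using act[OF ewH y] bracket_flip[of y "bracket e w"] by simp
    moreover obtain K where "(bracket y ^^ K) w = 0"
      using root_vector_locally_nilpotent[OF fd cartan y h(1)] h(2) unfolding locally_nilpotent_def by auto
    moreover have "(- 2 :: complex) \<noteq> of_nat k" for k
    proof
      assume "(- 2 :: complex) = of_nat k"
      then have "(of_int (- 2) :: complex) = of_int (int k)" by simp
      then have "- 2 = int k" by (simp only: of_int_eq_iff)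
      then show False by simp
    qed
    ultimately have "w = 0"
      using sl2_weight_injective[of e y h w "- 2" K] act[OF h(1) y] act[OF h(1) w] h(2) by (simp add: h_def)
    then show ?thesis by (auto simp: w_def)
  qed
  obtain c where c: "f j = scale c y" using line f[OF j] by blast
  have "c \<noteq> 0" using c f_nonzero[OF j] by auto
  then have y_eq: "y = scale (1 / c) (f j)" by (simp add: c)
  show ?thesis
  proof
    show "root_space H (\<lambda>h. - \<alpha> j h) \<subseteq> range (\<lambda>c. scale c (f j))"
      using line y_eq by (metis (no_types, lifting) rangeI scale_scale subsetI)
    show "range (\<lambda>c. scale c (f j)) \<subseteq> root_space H (\<lambda>h. - \<alpha> j h)"
      using f[OF j] subspace_root_space subspace_scale by blast
  qed
qed

text \<open>As the negative root space is the line through \<open>f j\<close>, the brackets with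
  \<open>f j\<close> already form the whole span that contains the coroot.\<close>

lemma exists_sl2_partner:
  assumes j: "j \<in> {1..n}"
  shows "\<exists>e\<in>root_space H (\<alpha> j). bracket e (f j) = hc j"
proof -
  let ?P = "{bracket x y | x y. x \<in> root_space H (\<alpha> j) \<and> y \<in> root_space H (\<lambda>k. - \<alpha> j k)}"
  let ?Q = "(\<lambda>x. bracket x (f j)) ` root_space H (\<alpha> j)"
  have "?P \<subseteq> ?Q"
  proof clarify
    fix x y assume x: "x \<in> root_space H (\<alpha> j)" and "y \<in> root_space H (\<lambda>k. - \<alpha> j k)"
    then obtain c where "y = scale c (f j)" using negative_simple_root_space[OF j] by blast
    then have "bracket x y = bracket (scale c x) (f j)"
      by (simp add: bracket_scale_left bracket_scale_right)
    then show "bracket x y \<in> ?Q" using x subspace_root_space subspace_scale by blast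
  qed
  moreover have "subspace ?Q"
  proof -
    interpret Vector_Spaces.linear scale scale "\<lambda>x. bracket x (f j)"
      by unfold_locales (simp_all add: bracket_add_left bracket_scale_left)
    show ?thesis by (rule subspace_image) (rule subspace_root_space)
  qed
  ultimately have "span ?P \<subseteq> ?Q" by (rule span_minimal)
  then show ?thesis
    using classical j unfolding of_classical_type_def is_coroot_def by force
qed

text \<open>A column with positive sum b gives weight -b under \<open>hc j\<close>, so z -> [f_j,
  [e, z]] is injective on the weight space by \<open>sl2_weight_injective\<close>, and surjective by
  finite dimension. The weight need not be a root.\<close>

lemma negative_root_space_step:
  fixes k :: "nat \<Rightarrow> nat"
  assumes k: "\<exists>i\<in>{1..n}. k i \<noteq> 0"
  shows "\<exists>j\<in>{1..n}. k j \<noteq> 0 \<and>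
    root_space H (\<lambda>h. - (\<Sum>i = 1..n. of_nat (k i) * \<alpha> i h)) \<subseteq>
    bracket (f j) ` root_space H (\<lambda>h. - (\<Sum>i = 1..n. of_nat ((k(j := k j - 1)) i) * \<alpha> i h))"
proof -
  have "valid_rank X n" using classical by (simp add: of_classical_type_def)
  with k obtain j where j: "j \<in> {1..n}" and pos: "(\<Sum>i = 1..n. int (k i) * cartan_matrix X n i j) > 0"
    using exists_positive_cartan_column_sum by blast
  define b where "b = (\<Sum>i = 1..n. int (k i) * cartan_matrix X n i j)"
  define a where "a = (\<lambda>h. - (\<Sum>i = 1..n. of_nat (k i) * \<alpha> i h))"
  \<comment> \<open>Without a contribution from the diagonal entry the column sum has only
    nonpositive terms.\<close>
  have kj: "k j \<noteq> 0"
  proof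
    assume "k j = 0"
    then have "b \<le> 0"
      unfolding b_def using cartan_matrix_nonpos
      by (intro sum_nonpos) (metis mult_nonneg_nonpos mult_zero_left of_nat_0 of_nat_0_le_iff)
    with pos show False by (simp add: b_def)
  qed
  have "\<alpha> i (hc j) = of_int (cartan_matrix X n i j)" if "i \<in> {1..n}" for i
    using classical that j by (simp add: of_classical_type_def)
  then have aj: "a (hc j) = of_int (- b)"
    by (simp add: a_def b_def)
  obtain e where e: "e \<in> root_space H (\<alpha> j)" "bracket e (f j) = hc j"
    using exists_sl2_partner[OF j] by blast
  have shift: "root_space H (\<lambda>h. \<alpha> j h + a h)
      = root_space H (\<lambda>h. - (\<Sum>i = 1..n. of_nat ((k(j := k j - 1)) i) * \<alpha> i h))"
  proof (rule root_space_cong)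
    fix h
    have "(\<Sum>i = 1..n. of_nat (k i) * \<alpha> i h) - (\<Sum>i = 1..n. of_nat ((k(j := k j - 1)) i) * \<alpha> i h)
        = (\<Sum>i = 1..n. if i = j then \<alpha> i h else 0)"
      unfolding sum_subtractf[symmetric]
      using kj by (intro sum.cong refl) (auto simp: of_nat_diff algebra_simps)
    then show "\<alpha> j h + a h = - (\<Sum>i = 1..n. of_nat ((k(j := k j - 1)) i) * \<alpha> i h)"
      using j by (simp add: a_def algebra_simps del: fun_upd_apply)
  qed
  have eZ: "bracket e z \<in> root_space H (\<lambda>h. \<alpha> j h + a h)" if "z \<in> root_space H a" for z
    using root_space_bracket[OF e(1) that] .
  obtain C where C: "finite C" "span C = UNIV" using fd unfolding finite_dimensional_def by blast
  have "(\<lambda>z. bracket (f j) (bracket e z)) ` root_space H a = root_space H a"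
  proof (rule injective_imp_surjective_on_subspace[OF C subspace_root_space])
    show "Vector_Spaces.linear scale scale (\<lambda>z. bracket (f j) (bracket e z))"
      by unfold_locales (simp_all add: bracket_add_right bracket_scale_right)
    fix z assume z: "z \<in> root_space H a"
    have "root_space H (\<lambda>h. - \<alpha> j h + (\<alpha> j h + a h)) = root_space H a"
      by (rule root_space_cong) simp
    then show "bracket (f j) (bracket e z) \<in> root_space H a"
      using root_space_bracket[OF f[OF j] eZ[OF z]] by simp
    assume 0: "bracket (f j) (bracket e z) = 0"
    obtain K where K: "(bracket (f j) ^^ K) z = 0"
      using f_locally_nilpotent[OF j] unfolding locally_nilpotent_def by blast
    show "z = 0"
    proof (rule sl2_weight_injective[OF e(2) _ _ 0 K])
      show "bracket (hc j) (f j) = scale (- 2) (f j)"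
        by (rule coroot_bracket_f[OF j])
      show "bracket (hc j) z = scale (of_int (- b)) z"
        using z coroot_in_cartan[OF j] by (simp add: root_space_def aj)
      show "(of_int (- b) :: complex) \<noteq> of_nat l" for l
        using pos by (metis b_def neg_less_0_iff_less not_less of_int_eq_iff of_int_of_nat_eq of_nat_0_le_iff)
    qed
  qed
  then have "root_space H a \<subseteq> bracket (f j) ` root_space H (\<lambda>h. \<alpha> j h + a h)"
    using eZ by blast
  with j kj show ?thesis unfolding shift unfolding a_def by blast
qed

text \<open>Negative root spaces are reached by induction on the height. Then \<open>M\<close>
  contains all root vectors, which makes it a nonzero ideal of a simple Lie algebra.\<close>

theorem generated_by_root_vectors:
  assumes M: "subspace M" "\<And>x y. x \<in> M \<Longrightarrow> y \<in> M \<Longrightarrow> bracket x y \<in> M"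
    and f_M: "\<And>j. j \<in> {1..n} \<Longrightarrow> f j \<in> M"
    and pos_M: "\<And>\<beta>. \<beta> \<in> positive_roots H n \<alpha> \<Longrightarrow> root_space H \<beta> \<subseteq> M"
  shows "M = UNIV"
proof -
  have neg: "root_space H (\<lambda>h. - (\<Sum>i = 1..n. of_nat (k i) * \<alpha> i h)) \<subseteq> M"
    if "\<exists>i\<in>{1..n}. k i \<noteq> 0" "(\<Sum>i = 1..n. k i) = N" for k :: "nat \<Rightarrow> nat" and N
    using that
  proof (induction N arbitrary: k)
    case 0
    then show ?case by simp
  next
    case (Suc N)
    let ?Z = "\<lambda>k :: nat \<Rightarrow> nat. root_space H (\<lambda>h. - (\<Sum>i = 1..n. of_nat (k i) * \<alpha> i h))"
    obtain j where j: "j \<in> {1..n}" "k j \<noteq> 0" and sub: "?Z k \<subseteq> bracket (f j) ` ?Z (k(j := k j - 1))"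
      using negative_root_space_step[OF Suc.prems(1)] by blast
    define k' where "k' = k(j := k j - 1)"
    have "(\<Sum>i = 1..n. k i) = (\<Sum>i = 1..n. k' i + (if i = j then 1 else 0))"
      using j by (intro sum.cong) (auto simp: k'_def)
    then have N: "(\<Sum>i = 1..n. k' i) = N"
      using Suc.prems(2) j by (simp add: sum.distrib)
    have "bracket (f j) u \<in> M" if u: "u \<in> ?Z k'" for u
    proof (cases "\<exists>i\<in>{1..n}. k' i \<noteq> 0")
      case True
      then show ?thesis using Suc.IH[OF True N] u M(2) f_M j(1) by blast
    next
      case False
      \<comment> \<open>At height one the step leads to weight 0, that is, into \<open>H\<close>,
        and \<open>f j\<close> bracketed with an element of \<open>H\<close> is a multiple of
        \<open>f j\<close>.\<close>
      then have "?Z k' = root_space H (\<lambda>_. 0)" by (intro root_space_cong) simp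
      with u have "u \<in> root_space H (\<lambda>_. 0)" by blast
      then have "u \<in> H"
        by (intro cartan_subalgebraD(3)[OF cartan]) (simp add: root_space_def)
      then have "bracket u (f j) = scale (- \<alpha> j u) (f j)" using f[OF j(1)] by (simp add: root_space_def)
      then have "bracket (f j) u = scale (\<alpha> j u) (f j)"
        using bracket_flip[of "f j" u] by simp
      then show ?thesis using M(1) f_M[OF j(1)] by (simp add: subspace_scale)
    qed
    with sub show ?case unfolding k'_def by blast
  qed
  have root_M: "root_space H \<beta> \<subseteq> M" if \<beta>: "\<beta> \<in> roots H" for \<beta>
  proof -
    obtain k :: "nat \<Rightarrow> nat" where
      k: "(\<forall>h\<in>H. \<beta> h = (\<Sum>i = 1..n. of_nat (k i) * \<alpha> i h)) \<or>
        (\<forall>h\<in>H. \<beta> h = - (\<Sum>i = 1..n. of_nat (k i) * \<alpha> i h))"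
      using classical \<beta> unfolding of_classical_type_def simple_roots_def by blast
    then show ?thesis
    proof
      assume "\<forall>h\<in>H. \<beta> h = (\<Sum>i = 1..n. of_nat (k i) * \<alpha> i h)"
      then show ?thesis using \<beta> pos_M unfolding positive_roots_def by blast
    next
      assume *: "\<forall>h\<in>H. \<beta> h = - (\<Sum>i = 1..n. of_nat (k i) * \<alpha> i h)"
      have "\<exists>i\<in>{1..n}. k i \<noteq> 0"
      proof (rule ccontr)
        assume "\<not> ?thesis"
        then have "\<forall>h\<in>H. \<beta> h = 0" using * by simp
        then show False using \<beta> by (auto simp: roots_def)
      qed
      moreover have "root_space H \<beta> = root_space H (\<lambda>h. - (\<Sum>i = 1..n. of_nat (k i) * \<alpha> i h))"
        using * by (intro root_space_cong) simp
      ultimately show ?thesis using neg by blast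
    qed
  qed
  have decomp: "x \<in> span (H \<union> (\<Union>\<beta>\<in>roots H. root_space H \<beta>))" for x
    using root_decomposition[OF fd cartan] by simp
  \<comment> \<open>It is not yet known that \<open>H\<close> lies in \<open>M\<close>, but brackets
    with \<open>H\<close> do: they scale root vectors and vanish on \<open>H\<close>.\<close>
  have H_M: "bracket h w \<in> M" if h: "h \<in> H" for h w
    using decomp[of w]
  proof (induction w rule: span_induct_alt)
    case (step c x w)
    have "bracket h x \<in> M"
      using step(1) h root_M cartan_subalgebraD(2)[OF cartan h] M(1)
      by (auto simp: root_space_def subspace_0 subspace_scale subset_iff)
    with step(2) show ?case
      using M(1) by (auto simp: bracket_add_right bracket_scale_right intro!: subspace_add subspace_scale)
  qed (simp add: M(1) subspace_0)
  have "bracket x w \<in> M" if w: "w \<in> M" for x w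
    using decomp[of x]
  proof (induction x rule: span_induct_alt)
    case (step c x y)
    have "bracket x w \<in> M" using step(1) H_M root_M M(2) w by blast
    with step(2) show ?case
      using M(1) by (auto simp: bracket_add_left bracket_scale_left intro!: subspace_add subspace_scale)
  qed (simp add: M(1) subspace_0)
  then have "lie_ideal M" using M(1) by (simp add: lie_ideal_def)
  moreover have "f 1 \<in> M" "f 1 \<noteq> 0" using f_M[of 1] f_nonzero[of 1] rank_pos by auto
  ultimately show ?thesis using simple unfolding simple_def by blast
qed

end

section \<open>Current algebras and Kirillov--Reshetikhin modules\<close>

context lie_algebra
begin

lemma current_scale_monom: "current_scale scale c (monom x r) = monom (scale c x) r"
  by (simp add: poly_eq_iff coeff_current_scale)

lemma poly_sum_monom:
  fixes p :: "'g poly"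
  shows "p = (\<Sum>r\<le>degree p. monom (coeff p r) r)"
  by (auto simp: poly_eq_iff coeff_sum coeff_eq_0)

lemma current_bracket_pow_monom:
  "(current_bracket bracket (monom s a) ^^ k) (monom y b) = monom ((bracket s ^^ k) y) (k * a + b)"
  by (induction k) (simp_all add: current_bracket_monom add.assoc)

lemma current_locally_nilpotent:
  assumes "locally_nilpotent (bracket s)"
  shows "locally_nilpotent (current_bracket bracket (monom s a))"
proof -
  interpret L: lie_algebra "current_scale scale" "current_bracket bracket" by (rule lie_algebra_current)
  interpret adj: lie_rep "current_scale scale" "current_bracket bracket" "current_scale scale" "current_bracket bracket"
    by (rule L.lie_rep_adjoint)
  have "p \<in> {p. \<exists>k. (current_bracket bracket (monom s a) ^^ k) p = 0}" for p
  proof (induction p rule: poly_monom_induct)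
    case (monom x r)
    obtain k where "(bracket s ^^ k) x = 0" using assms unfolding locally_nilpotent_def by blast
    then have "(current_bracket bracket (monom s a) ^^ k) (monom x r) = 0"
      by (simp add: current_bracket_pow_monom)
    then show ?case by blast
  next
    case (add p q)
    then show ?case by (rule L.subspace_add[OF adj.subspace_rep_nilpotent])
  qed
  then show ?thesis unfolding locally_nilpotent_def by blast
qed

end

context classical_lie_algebra
begin

text \<open>\<open>generated_by_root_vectors\<close> is applied to the set of all x such that x t^r
  lies in \<open>M\<close> for every r.\<close>

lemma current_algebra_generated:
  assumes M: "module.subspace (current_scale scale) M"
    "\<And>x y. x \<in> M \<Longrightarrow> y \<in> M \<Longrightarrow> current_bracket bracket x y \<in> M"
    and f_M: "\<And>j. j \<in> {1..n} \<Longrightarrow> monom (f j) 0 \<in> M"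
    and pos_M: "\<And>\<beta> e r. \<beta> \<in> positive_roots H n \<alpha> \<Longrightarrow> e \<in> root_space H \<beta> \<Longrightarrow> monom e r \<in> M"
  shows "M = UNIV"
proof -
  interpret L: lie_algebra "current_scale scale" "current_bracket bracket" by (rule lie_algebra_current)
  have "{x. \<forall>r. monom x r \<in> M} = UNIV"
  proof (rule generated_by_root_vectors)
    show "subspace {x. \<forall>r. monom x r \<in> M}"
    proof (rule subspaceI)
      fix x y c assume x: "x \<in> {x. \<forall>r. monom x r \<in> M}"
      show "scale c x \<in> {x. \<forall>r. monom x r \<in> M}"
        using x M(1) L.subspace_scale by (auto simp: current_scale_monom[symmetric])
      assume y: "y \<in> {x. \<forall>r. monom x r \<in> M}"
      show "x + y \<in> {x. \<forall>r. monom x r \<in> M}"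
        using x y M(1) by (auto simp: add_monom[symmetric] L.subspace_add)
    qed (simp add: M(1) L.subspace_0)
    show "bracket x y \<in> {x. \<forall>r. monom x r \<in> M}"
      if "x \<in> {x. \<forall>r. monom x r \<in> M}" "y \<in> {x. \<forall>r. monom x r \<in> M}" for x y
    proof clarify
      fix r
      have "current_bracket bracket (monom x r) (monom y 0) \<in> M" using that M(2) by blast
      then show "monom (bracket x y) r \<in> M" by (simp add: current_bracket_monom)
    qed
    show "root_space H \<beta> \<subseteq> {x. \<forall>r. monom x r \<in> M}" if "\<beta> \<in> positive_roots H n \<alpha>" for \<beta>
      using pos_M that by blast
    fix j assume j: "j \<in> {1..n}"
    show "f j \<in> {x. \<forall>r. monom x r \<in> M}"
    proof clarify
      fix r
      \<comment> \<open>From f_j in degree 0 one gets [e t^r, f_j] = h_j t^r and then [h_j t^r, f_j]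
        = -2 f_j t^r.\<close>
      obtain e where e: "e \<in> root_space H (\<alpha> j)" "bracket e (f j) = hc j"
        using exists_sl2_partner[OF j] by blast
      have "current_bracket bracket (monom e r) (monom (f j) 0) \<in> M"
        using pos_M[OF simple_roots_positive[OF _ j] e(1)] classical f_M[OF j] M(2)
        unfolding of_classical_type_def by blast
      then have "monom (hc j) r \<in> M" by (simp add: current_bracket_monom e(2))
      then have "current_bracket bracket (monom (hc j) r) (monom (f j) 0) \<in> M"
        using f_M[OF j] M(2) by blast
      then have "monom (scale (- 2) (f j)) r \<in> M"
        using coroot_bracket_f[OF j] by (simp add: current_bracket_monom)
      then have "current_scale scale (- 1 / 2) (monom (scale (- 2) (f j)) r) \<in> M"
        using M(1) L.subspace_scale by blast
      then show "monom (f j) r \<in> M" by (simp add: current_scale_monom)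
    qed
  qed
  then have "monom x r \<in> M" for x r by blast
  then have "p \<in> M" for p
    by (induction p rule: poly_monom_induct) (use M(1) L.subspace_add in blast)+
  then show ?thesis by blast
qed

text \<open>This supplies the data for \<open>finite_dimensional_presented_module\<close>:
  \<open>?S\<close> consists of the positive root vectors in all degrees and the f_j in degree 0,
  \<open>?K\<close> is t^T g[t], and the products of a basis with t^r for r < T span modulo
  \<open>?K\<close>.\<close>

lemma finite_dimensional_KR:
  assumes i: "i \<in> {1..n}" and xm: "\<And>j. j \<in> {1..n} \<Longrightarrow> xm (\<alpha> j) = f j"
  shows "finite_dimensional_module (KR H n \<alpha> \<omega> xm m i)"
proof -
  interpret L: lie_algebra "current_scale scale" "current_bracket bracket" by (rule lie_algebra_current)
  let ?R = "KR_relations H n \<alpha> \<omega> xm m i"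
  define N where "N = relation_ideal (current_scale scale) (current_bracket bracket) ?R"
  \<comment> \<open>\<open>D\<close> is the annihilator of the cyclic vector in the current algebra,
    a Lie subalgebra.\<close>
  define D where "D = {p. generator p \<in> N}"
  note gen = generator_in_relation_ideal[where scale = "current_scale scale" and bracket = "current_bracket bracket" and R = ?R, folded N_def]
  note closed = relation_ideal_closed[where scale = "current_scale scale" and bracket = "current_bracket bracket" and R = ?R, folded N_def]
  have sub_D: "L.subspace D"
  proof (rule L.subspaceI)
    show "0 \<in> D" using generator_relations(2)[where scale = "current_scale scale" and bracket = "current_bracket bracket" and R = ?R and c = 0 and x = 0 and p = 1]
      by (simp add: D_def N_def scalar_simps)
  qed (simp_all add: D_def gen)
  have bracket_D: "current_bracket bracket p q \<in> D" if "p \<in> D" "q \<in> D" for p q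
    using that by (simp add: D_def gen)
  have monom_scale: "monom (scale c x) r \<in> D" if "monom x r \<in> D" for c x r
    using L.subspace_scale[OF sub_D that, of c] by (simp add: current_scale_monom)
  have pos_D: "monom e r \<in> D" if "\<beta> \<in> positive_roots H n \<alpha>" "e \<in> root_space H \<beta>" for \<beta> e r
  proof -
    have "e \<in> n_plus H n \<alpha>" unfolding n_plus_def using that by (intro span_base) blast
    then have "\<forall>s. coeff (monom e r) s \<in> n_plus H n \<alpha>" by (simp add: n_plus_def span_zero)
    then have "generator (monom e r) \<in> ?R" unfolding KR_relations_def by blast
    then show ?thesis by (simp add: D_def closed(5))
  qed
  have H_D: "monom h r \<in> D" if "h \<in> H" "r \<ge> 1" for h r
  proof -
    have "generator (monom h r) \<in> ?R" using that unfolding KR_relations_def by blast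
    then show ?thesis by (simp add: D_def closed(5))
  qed
  have f_nil: "generator (monom (f i) 0) ^ (m + 1) \<in> N"
    by (rule closed(5)) (simp add: KR_relations_def xm[OF i])
  have f_D0: "monom (f j) 0 \<in> D" if "j \<in> {1..n}" "j \<noteq> i" for j
  proof -
    have "generator (monom (f j) 0) \<in> ?R"
      unfolding KR_relations_def using that xm[OF that(1)] by auto
    then show ?thesis by (simp add: D_def closed(5))
  qed
  \<comment> \<open>Bracketing with h_j t^r, which kills the cyclic vector for positive r, raises
    the degree. Below, this starts from degree 1 for j = i and from degree 0 otherwise.\<close>
  have f_bracket: "monom (f j) (r + s) \<in> D" if j: "j \<in> {1..n}" and r: "r \<ge> 1" and "monom (f j) s \<in> D" for j r s
  proof -
    have "current_bracket bracket (monom (hc j) r) (monom (f j) s) \<in> D"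
      using bracket_D H_D[OF coroot_in_cartan[OF j] r] that(3) by blast
    then have "monom (scale (- 2) (f j)) (r + s) \<in> D"
      using coroot_bracket_f[OF j] by (simp add: current_bracket_monom)
    then show ?thesis using monom_scale[of "scale (- 2) (f j)" "r + s" "- 1 / 2"] by simp
  qed
  have f_D: "monom (f j) r \<in> D" if j: "j \<in> {1..n}" and r: "r \<ge> 1" for j r
  proof (cases "j = i")
    case True
    have "generator (monom (f i) 1) \<in> N"
      by (rule closed(5)) (simp add: KR_relations_def xm[OF i])
    then have 1: "monom (f i) 1 \<in> D" by (simp add: D_def)
    show ?thesis
    proof (cases "r = 1")
      case False
      then show ?thesis using f_bracket[OF i _ 1, of "r - 1"] r True by simp
    qed (use 1 True in simp)
  next
    case False
    then show ?thesis using f_bracket[OF j r f_D0[OF j]] by simp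
  qed
  \<comment> \<open>These x form a subalgebra because thresholds add under brackets; it contains all
    the generating root vectors.\<close>
  have bounded: "{x. \<exists>k. \<forall>r\<ge>k. monom x r \<in> D} = UNIV"
  proof (rule generated_by_root_vectors)
    show "subspace {x. \<exists>k. \<forall>r\<ge>k. monom x r \<in> D}"
    proof (rule subspaceI)
      fix x y c assume x: "x \<in> {x. \<exists>k. \<forall>r\<ge>k. monom x r \<in> D}"
      show "scale c x \<in> {x. \<exists>k. \<forall>r\<ge>k. monom x r \<in> D}"
        using x monom_scale by blast
      assume y: "y \<in> {x. \<exists>k. \<forall>r\<ge>k. monom x r \<in> D}"
      from x y obtain k l where "\<forall>r\<ge>k. monom x r \<in> D" "\<forall>r\<ge>l. monom y r \<in> D" by blast
      then have "\<forall>r\<ge>max k l. monom (x + y) r \<in> D"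
        using L.subspace_add[OF sub_D] by (simp add: add_monom[symmetric])
      then show "x + y \<in> {x. \<exists>k. \<forall>r\<ge>k. monom x r \<in> D}" by blast
    qed (use sub_D L.subspace_0 in auto)
    show "bracket x y \<in> {x. \<exists>k. \<forall>r\<ge>k. monom x r \<in> D}"
      if xy: "x \<in> {x. \<exists>k. \<forall>r\<ge>k. monom x r \<in> D}" "y \<in> {x. \<exists>k. \<forall>r\<ge>k. monom x r \<in> D}" for x y
    proof -
      from xy obtain k l where kl: "\<forall>r\<ge>k. monom x r \<in> D" "\<forall>r\<ge>l. monom y r \<in> D" by blast
      have "monom (bracket x y) r \<in> D" if "r \<ge> k + l" for r
      proof -
        have "current_bracket bracket (monom x k) (monom y (r - k)) \<in> D"
          using kl that by (intro bracket_D) auto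
        then show ?thesis using that by (simp add: current_bracket_monom)
      qed
      then show ?thesis by blast
    qed
  qed (use f_D pos_D in blast)+
  obtain B where B: "finite B" "span B = UNIV" using fd unfolding finite_dimensional_def by blast
  have "\<forall>b. \<exists>k. \<forall>r\<ge>k. monom b r \<in> D" using bounded by blast
  then obtain k where k: "\<And>b r. r \<ge> k b \<Longrightarrow> monom b r \<in> D" by metis
  \<comment> \<open>One threshold for all basis elements; inserting 0 keeps the maximum defined when
    \<open>B\<close> is empty.\<close>
  define T where "T = Max (insert 0 (k ` B))"
  have T: "monom x r \<in> D" if r: "r \<ge> T" for x r
  proof -
    have "x \<in> span B" using B(2) by blast
    then show ?thesis
    proof (induction x rule: span_induct_alt)
      case (step c b y)
      have "k b \<le> T" unfolding T_def using B(1) step(1) by (intro Max_ge) auto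
      then have "monom b r \<in> D" using r k by simp
      then show ?case
        using step(2) L.subspace_add[OF sub_D] monom_scale by (simp add: add_monom[symmetric])
    qed (simp add: L.subspace_0 sub_D)
  qed
  let ?K = "{p :: 'g poly. \<forall>r<T. coeff p r = 0}"
  let ?S = "{monom e r | e r \<beta>. \<beta> \<in> positive_roots H n \<alpha> \<and> e \<in> root_space H \<beta>} \<union> {monom (f j) 0 | j. j \<in> {1..n}}"
  have S_nil: "locally_nilpotent (current_bracket bracket s)" if s: "s \<in> ?S" for s
  proof -
    from s consider e r \<beta> where "s = monom e r" "\<beta> \<in> positive_roots H n \<alpha>" "e \<in> root_space H \<beta>"
      | j where "s = monom (f j) 0" "j \<in> {1..n}" by blast
    then show ?thesis
    proof cases
      case 1
      then obtain h where "h \<in> H" "\<beta> h \<noteq> 0" unfolding positive_roots_def roots_def by blast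
      with 1 show ?thesis
        using root_vector_locally_nilpotent[OF fd cartan] current_locally_nilpotent by blast
    next
      case 2
      then show ?thesis using f_locally_nilpotent current_locally_nilpotent by blast
    qed
  qed
  \<comment> \<open>Only f_i in degree 0 needs the power m + 1; all other elements of
    \<open>?S\<close> kill the cyclic vector.\<close>
  have S_N: "\<exists>l. generator s ^ l \<in> N" if s: "s \<in> ?S" for s
  proof (cases "s = monom (f i) 0")
    case False
    then have "s \<in> D" using s pos_D f_D0 by blast
    then show ?thesis by (auto simp: D_def intro: exI[of _ 1])
  qed (use f_nil in blast)
  have K_N: "generator p \<in> N" if p: "p \<in> ?K" for p
  proof -
    have "monom (coeff p r) r \<in> D" for r
      using p T[of r] L.subspace_0[OF sub_D] by (cases "r < T") auto
    then have "(\<Sum>r\<le>degree p. monom (coeff p r) r) \<in> D"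
      using sub_D by (intro L.subspace_sum) auto
    then show ?thesis by (simp add: D_def flip: poly_sum_monom)
  qed
  show ?thesis
    unfolding KR_def
  proof (rule finite_dimensional_presented_module[OF lie_algebra_current, of ?S _ ?K])
    show "M = UNIV" if "module.subspace (current_scale scale) M" "?S \<subseteq> M"
      "\<And>x y. x \<in> M \<Longrightarrow> y \<in> M \<Longrightarrow> current_bracket bracket x y \<in> M" for M
      by (rule current_algebra_generated) (use that in blast)+
    show "current_bracket bracket x y \<in> ?K" if "x \<in> ?K" for x y
      using that by (simp add: coeff_current_bracket)
    show "finite ((\<lambda>(b, r). monom b r) ` (B \<times> {..<T}))" using B(1) by simp
    fix p :: "'g poly"
    let ?C = "(\<lambda>(b, r). monom b r) ` (B \<times> {..<T})"
    have "monom x r \<in> L.span ?C" if r: "r < T" for x r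
    proof -
      have "x \<in> span B" using B(2) by blast
      then show ?thesis
      proof (induction x rule: span_induct_alt)
        case (step c b y)
        have "monom b r \<in> L.span ?C"
          using step(1) r by (intro L.span_base image_eqI[of _ _ "(b, r)"]) auto
        then have "current_scale scale c (monom b r) + monom y r \<in> L.span ?C"
          using step(2) by (intro L.span_add L.span_scale)
        then show ?case by (simp add: add_monom current_scale_monom)
      qed (simp add: L.span_zero)
    qed
    then have "(\<Sum>r<T. monom (coeff p r) r) \<in> L.span ?C" by (intro L.span_sum) auto
    moreover have "p - (\<Sum>r<T. monom (coeff p r) r) \<in> ?K"
      by (auto simp: coeff_sum)
    ultimately show "\<exists>z\<in>L.span ?C. p - z \<in> ?K" by blast
  qed (use S_nil S_N K_N in \<open>simp_all add: N_def\<close>)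
qed

end

theorem mainTheorem3:
  fixes scale :: "complex \<Rightarrow> 'g::ab_group_add \<Rightarrow> 'g"
    and bracket :: "'g \<Rightarrow> 'g \<Rightarrow> 'g"
    and H :: "'g set"
    and X :: classical_type
    and n :: nat
    and \<alpha> \<omega> :: "nat \<Rightarrow> 'g \<Rightarrow> complex"
    and hc :: "nat \<Rightarrow> 'g"
    and xm :: "('g \<Rightarrow> complex) \<Rightarrow> 'g"
    and i m :: nat
  assumes "lie_algebra scale bracket"
    and "lie_algebra.finite_dimensional scale"
    and "lie_algebra.simple scale bracket"
    and "lie_algebra.cartan_subalgebra scale bracket H"
    and "lie_algebra.of_classical_type scale bracket X H n \<alpha> hc"
    and "lie_algebra.fundamental_weights scale H n hc \<omega>"
    and "\<forall>\<beta>\<in>lie_algebra.positive_roots scale bracket H n \<alpha>.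
           xm \<beta> \<in> lie_algebra.root_space scale bracket H (\<lambda>h. - \<beta> h) \<and> xm \<beta> \<noteq> 0"
    and "i \<in> {1..n}"
  shows "finite_dimensional_module (lie_algebra.KR scale bracket H n \<alpha> \<omega> xm m i)"
proof -
  interpret lie_algebra scale bracket by (rule assms(1))
  have "simple_roots H n \<alpha>" using assms(5) by (simp add: of_classical_type_def)
  then have "xm (\<alpha> j) \<in> root_space H (\<lambda>h. - \<alpha> j h) \<and> xm (\<alpha> j) \<noteq> 0" if "j \<in> {1..n}" for j
    using assms(7) simple_roots_positive that by blast
  then interpret classical_lie_algebra scale bracket H X n \<alpha> hc "\<lambda>j. xm (\<alpha> j)"
    using assms(2-5) by unfold_locales auto
  show ?thesis using finite_dimensional_KR[OF assms(8)] by simp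
qed

end
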